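(* Suppose the underlying ring $R$ is a field (so $\mathbb Q\subseteq R\subseteq\mathbb R$). For any exchange matrix $B$, there exists an extended exchange matrix $\tilde B$ with exchange matrix $B$ that is universal over $R$. The cluster algebra $\mathcal A_R(\tilde B)$ has universal geometric coefficients over $R$; that is, for every extended exchange matrix $\tilde B'$ over $R$ with exchange matrix $B$ there is a unique coefficient specialization from $\mathcal A_R(\tilde B)$ to $\mathcal A_R(\tilde B')$.
   Context: **Basic conventions.** $[n]=\{1,\dots,n\}$; $[a]_+=\max(a,0)$; $\operatorname{sgn}(a)\in\{-1,0,1\}$ is the sign of $a$. An *underlying ring* $R$ is either $\mathbb Z$ or a field with $\mathbb Q\subseteq R\subseteq\mathbb R$. An *exchange matrix* is an $n\times n$ integer matrix $B=(b_{ij})$ that is skew-symmetrizable: there are positive integers $d_i$ with $d_ib_{ij}=-d_jb_{ji}$ for all $i,j$. An *extended exchange matrix* $\tilde B$ (over $R$) is a matrix with rows indexed by $[n]\sqcup I$ ($I$ an arbitrary, possibly infinite, index set) and columns indexed by $[n]$, with entries in $R$, whose rows indexed by $[n]$ form an exchange matrix $B$; the rows $\mathbf b_i=(b_{i1},\dots,b_{in})$, $i\in I$, are its *coefficient rows*. For $k\in[n]$, the mutation $\mu_k(\tilde B)=\tilde B'$ has $b'_{ij}=-b_{ij}$ if $i=k$ or $j=k$, and $b'_{ij}=b_{ij}+\operatorname{sgn}(b_{kj})[b_{ik}b_{kj}]_+$ otherwise. **Tropical semifields.** $\mathbb P=\mathrm{Trop}_R(u_i:i\in I)$ is the multiplicative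 abelian group of formal products $\prod_{i\in I}u_i^{a_i}$, $a_i\in R$, with exponents adding under multiplication, with unit $1$, and auxiliary addition $\prod u_i^{a_i}\oplus\prod u_i^{b_i}=\prod u_i^{\min(a_i,b_i)}$. It is an $R$-module, $c\in R$ acting by $\prod u_i^{a_i}\mapsto\prod u_i^{ca_i}$, and carries the product topology, each factor $R$ being discrete. $\mathbb Z\mathbb P$, $\mathbb Q\mathbb P$ are the group rings of the multiplicative group $\mathbb P$. **Seeds and cluster algebras.** Let $\mathbb K$ be a field isomorphic to the field of rational functions in $n$ variables with coefficients in $\mathbb Q\mathbb P$. A (labeled geometric) seed is a pair $(\mathbf x,\tilde B)$ with $\tilde B$ an extended exchange matrix over $R$ with coefficient rows indexed by $I$ and $\mathbf x=(x_1,\dots,x_n)$ algebraically independent elements generating $\mathbb K$. Its coefficients are $y_j=\prod_{i\in I}u_i^{b_{ij}}$. The mutation $\mu_k(\mathbf x,\tilde B)=(\mathbf x',\mu_k(\tilde B))$ has $x'_j=x_j$ for $j\ne k$ and $$x'_k=\frac{y_k\prod_{i=1}^nx_i^{[b_{ik}]_+}+\prod_{i=1}^nx_i^{[-b_{ik}]_+}}{x_k(y_k\oplus1)}.$$ $\mathbb T_n$ is the $n$-regular tree with edges labeled by $[n]$, each vertex being incident to exactly one edge of each label; $t_0$ is a fixed vertex. Given a seed $(\mathbf x,\tilde B)$, the cluster pattern assigns to each vertex $t$ a seed $(\mathbf x_t,\tilde B_t)$, with $(\mathbf x_{t_0},\tilde B_{t_0})=(\mathbf x,\tilde B)$ and $(\mathbf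 x_{t'},\tilde B_{t'})=\mu_k(\mathbf x_t,\tilde B_t)$ when $t,t'$ are joined by an edge labeled $k$. Write $x_{j;t}$ and $y_{j;t}$ for the cluster variables and coefficients of the seed at $t$. The cluster algebra $\mathcal A_R(\mathbf x,\tilde B)$ (also $\mathcal A_R(\tilde B)$) is the $\mathbb Z\mathbb P$-subalgebra of $\mathbb K$ generated by all $x_{j;t}$. **Coefficient specialization and universality.** Let $(\mathbf x,\tilde B)$, $(\mathbf x',\tilde B')$ be seeds of rank $n$ with tropical semifields $\mathbb P,\mathbb P'$ over the same $R$. A ring homomorphism $\varphi:\mathcal A_R(\mathbf x,\tilde B)\to\mathcal A_R(\mathbf x',\tilde B')$ is a *coefficient specialization* if (i) the exchange matrices $B$ and $B'$ coincide; (ii) $\varphi(x_j)=x'_j$ for all $j$; (iii) the restriction of $\varphi$ to $\mathbb P$ is a continuous $R$-linear map to $\mathbb P'$ with $\varphi(y_{j;t})=y'_{j;t}$ and $\varphi(y_{j;t}\oplus1)=y'_{j;t}\oplus1$ for all $j\in[n]$, $t\in\mathbb T_n$. $\tilde B$ is *universal over $R$* if for every extended exchange matrix $\tilde B'$ over $R$ with the same exchange matrix $B$ (and any index set for the coefficient rows) there is a unique coefficient specialization $\mathcal A_R(\tilde B)\to\mathcal A_R(\tilde B')$; its coefficient rows are then called universal geometric coefficients for $B$ over $R$. *)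

theory Defs
  imports
    "HOL-Analysis.Analysis"
    "HOL-Library.Poly_Mapping"
    "HOL-Library.FuncSet"
    "HOL-Computational_Algebra.Fraction_Field"
begin

section \<open>Tropical semifields\<close>

text \<open>
  An element of type \<open>'i trop\<close> is the formal product of all \<open>u\<^sub>i\<close> to the power
  \<open>texp a i\<close>. Since \<open>Poly_Mapping\<close> builds (semi)group rings over additively written
  monoids, the multiplicative group of the tropical semifield is written
  \<^emph>\<open>additively\<close> here: \<open>+\<close> on \<open>'i trop\<close> is the semifield multiplication, and \<open>0\<close> is its unit.
  The auxiliary addition of the semifield is \<open>tplus\<close> below.
\<close>

typedef 'i trop = "UNIV :: ('i \<Rightarrow> real) set"
  morphisms texp Trop by simp

lemma texp_Trop [simp]: "texp (Trop f) = f"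
  by (simp add: Trop_inverse)

lemma trop_eq_iff: "a = b \<longleftrightarrow> (\<forall>i. texp a i = texp b i)"
  by (metis ext texp_inject)

text \<open>
  The linear order below (lexicographic for some well-order of the indices) has no mathematical
  meaning in what follows. It only serves to meet the sort constraint under which
  \<open>Poly_Mapping\<close> provides the instance \<open>idom\<close>, i.e. to know that the group ring
  is a domain and so has a field of fractions.
\<close>

definition index_wo :: "'i rel" where
  "index_wo = (SOME r. well_order_on UNIV r)"

lemma index_wo: "well_order_on UNIV (index_wo :: 'i rel)"
  unfolding index_wo_def by (rule someI_ex) (rule well_order_on)

lemma index_wo_least:
  fixes P :: "'i \<Rightarrow> bool"
  assumes "P k"
  shows "\<exists>i. P i \<and> (\<forall>j. (j, i) \<in> index_wo - Id \<longrightarrow> \<not> P j)"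
proof -
  have "wf (index_wo - Id :: 'i rel)"
    using index_wo unfolding well_order_on_def by blast
  moreover have "k \<in> Collect P"
    using assms by simp
  ultimately obtain i where "i \<in> Collect P" "\<And>j. (j, i) \<in> index_wo - Id \<Longrightarrow> j \<notin> Collect P"
    by (erule wfE_min)
  then show ?thesis by (intro exI[of _ i]) simp
qed

lemma index_wo_total: "i \<noteq> j \<Longrightarrow> (i, j) \<in> index_wo - Id \<or> (j, i) \<in> index_wo - Id"
  using index_wo unfolding well_order_on_def linear_order_on_def total_on_def by auto

lemma index_wo_trans:
  assumes "(i, j) \<in> index_wo - Id" and "(j, k) \<in> index_wo - Id"
  shows "(i, k) \<in> index_wo - Id"
proof -
  have "trans (index_wo :: 'a rel)" "antisym (index_wo :: 'a rel)"
    using index_wo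
    unfolding well_order_on_def linear_order_on_def partial_order_on_def preorder_on_def by auto
  then show ?thesis
    using assms unfolding trans_def antisym_def by blast
qed

instantiation trop :: (type) linordered_ab_group_add
begin

definition zero_trop :: "'a trop" where "0 = Trop (\<lambda>_. 0)"

definition plus_trop :: "'a trop \<Rightarrow> 'a trop \<Rightarrow> 'a trop"
  where "a + b = Trop (\<lambda>i. texp a i + texp b i)"

definition uminus_trop :: "'a trop \<Rightarrow> 'a trop"
  where "- a = Trop (\<lambda>i. - texp a i)"

definition minus_trop :: "'a trop \<Rightarrow> 'a trop \<Rightarrow> 'a trop"
  where "a - b = Trop (\<lambda>i. texp a i - texp b i)"

definition less_trop :: "'a trop \<Rightarrow> 'a trop \<Rightarrow> bool"
  where "a < b \<longleftrightarrow>
    (\<exists>i. texp a i < texp b i \<and> (\<forall>j. (j, i) \<in> index_wo - Id \<longrightarrow> texp a j = texp b j))"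

definition less_eq_trop :: "'a trop \<Rightarrow> 'a trop \<Rightarrow> bool"
  where "less_eq_trop a b \<longleftrightarrow> a = b \<or> a < b"

instance
proof
  fix a b c :: "'a trop"
  have irrefl: "\<not> x < x" for x :: "'a trop"
    by (simp add: less_trop_def)
  have less_tr: "x < z" if xyz: "x < y" "y < z" for x y z :: "'a trop"
  proof -
    from xyz(1)[unfolded less_trop_def]
    obtain i where i: "texp x i < texp y i"
      "\<And>j. (j, i) \<in> index_wo - Id \<Longrightarrow> texp x j = texp y j"
      by blast
    from xyz(2)[unfolded less_trop_def]
    obtain k where k: "texp y k < texp z k"
      "\<And>j. (j, k) \<in> index_wo - Id \<Longrightarrow> texp y j = texp z j"
      by blast
    consider "i = k" | "(i, k) \<in> index_wo - Id" | "(k, i) \<in> index_wo - Id"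
      using index_wo_total[of i k] by argo
    then have "\<exists>l. texp x l < texp z l \<and> (\<forall>j. (j, l) \<in> index_wo - Id \<longrightarrow> texp x j = texp z j)"
    proof cases
      case 1
      have "texp x i < texp z i"
        using i(1) k(1) 1 by simp
      moreover have "texp x j = texp z j" if "(j, i) \<in> index_wo - Id" for j
        using i(2)[OF that] k(2)[of j] that 1 by metis
      ultimately show ?thesis by blast
    next
      case 2
      have "texp x i < texp z i"
        using i(1) k(2)[OF 2] by linarith
      moreover have "texp x j = texp z j" if "(j, i) \<in> index_wo - Id" for j
        using i(2)[OF that] k(2)[OF index_wo_trans[OF that 2]] by (rule trans)
      ultimately show ?thesis by blast
    next
      case 3
      have "texp x k < texp z k"
        using k(1) i(2)[OF 3] by linarith
      moreover have "texp x j = texp z j" if "(j, k) \<in> index_wo - Id" for j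
        using i(2)[OF index_wo_trans[OF that 3]] k(2)[OF that] by (rule trans)
      ultimately show ?thesis by blast
    qed
    then show ?thesis unfolding less_trop_def .
  qed
  show "a + b + c = a + (b + c)" "a + b = b + a" "0 + a = a" "- a + a = 0" "a - b = a + - b"
    by (simp_all add: trop_eq_iff plus_trop_def zero_trop_def uminus_trop_def minus_trop_def)
  show "(a < b) = (a \<le> b \<and> \<not> b \<le> a)"
    unfolding less_eq_trop_def using irrefl[of a] less_tr[of a b a] by auto
  show "a \<le> a"
    by (simp add: less_eq_trop_def)
  show "a \<le> c" if "a \<le> b" "b \<le> c"
    using that less_tr[of a b c] unfolding less_eq_trop_def by auto
  show "a = b" if "a \<le> b" "b \<le> a"
    using that irrefl[of a] less_tr[of a b a] unfolding less_eq_trop_def by auto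
  show "a \<le> b \<or> b \<le> a"
  proof (cases "a = b")
    case False
    then obtain k where "texp a k \<noteq> texp b k"
      by (auto simp: trop_eq_iff)
    then obtain i where i: "texp a i \<noteq> texp b i"
      "\<forall>j. (j, i) \<in> index_wo - Id \<longrightarrow> texp a j = texp b j"
      using index_wo_least[of "\<lambda>i. texp a i \<noteq> texp b i" k] by auto
    then consider "texp a i < texp b i" | "texp b i < texp a i"
      by linarith
    then show ?thesis
      unfolding less_eq_trop_def less_trop_def using i by cases (metis, metis)
  qed (simp add: less_eq_trop_def)
  show "c + a \<le> c + b" if "a \<le> b"
    using that by (auto simp: less_eq_trop_def less_trop_def plus_trop_def)
qed

end

definition tplus :: "'i trop \<Rightarrow> 'i trop \<Rightarrow> 'i trop" where
  "tplus a b = Trop (\<lambda>i. min (texp a i) (texp b i))"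

definition tscale :: "real \<Rightarrow> 'i trop \<Rightarrow> 'i trop" where
  "tscale c a = Trop (\<lambda>i. c * texp a i)"

text \<open>
  The underlying ring is a subset \<open>R\<close> of the reals, and the index set of a tropical
  semifield is a subset \<open>I\<close> of a type, which may be empty. The tropical semifield over \<open>R\<close>
  in the variables \<open>u\<^sub>i\<close> with \<open>i \<in> I\<close> consists of the elements of \<open>'i trop\<close> with
  exponents in \<open>R\<close> for \<open>i \<in> I\<close>, exponents outside \<open>I\<close> being set to \<open>0\<close>.
\<close>

definition underlying_field :: "real set \<Rightarrow> bool" where
  "underlying_field R \<longleftrightarrow> \<rat> \<subseteq> R \<and>
     (\<forall>a\<in>R. \<forall>b\<in>R. a + b \<in> R \<and> a * b \<in> R) \<and> (\<forall>a\<in>R. - a \<in> R \<and> inverse a \<in> R)"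

definition tropical :: "real set \<Rightarrow> 'i set \<Rightarrow> 'i trop set" where
  "tropical R I = {a. (\<forall>i\<in>I. texp a i \<in> R) \<and> (\<forall>i. i \<notin> I \<longrightarrow> texp a i = 0)}"

definition tropical_topology :: "real set \<Rightarrow> 'i set \<Rightarrow> 'i trop topology" where
  "tropical_topology R I =
     pullback_topology (tropical R I) (\<lambda>a. restrict (texp a) I)
       (product_topology (\<lambda>_. discrete_topology R) I)"

section \<open>Extended exchange matrices\<close>

definition exchange_matrix :: "int ^ 'n ^ 'n \<Rightarrow> bool" where
  "exchange_matrix B \<longleftrightarrow>
     (\<exists>d :: 'n \<Rightarrow> int. (\<forall>i. 0 < d i) \<and> (\<forall>i j. d i * B $ i $ j = - (d j * B $ j $ i)))"

text \<open>
  The index type \<open>'n\<close> plays the role of \<open>[n]\<close>. Rows of an extended matrix are indexed by the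
  disjoint union of \<open>'n\<close> and \<open>I\<close>, so that only the rows \<open>Inl k\<close> and the rows \<open>Inr i\<close> with
  \<open>i \<in> I\<close> are meaningful.
\<close>

type_synonym ('n, 'i) ext_matrix = "'n + 'i \<Rightarrow> 'n \<Rightarrow> real"

definition extends_matrix :: "('n::finite, 'i) ext_matrix \<Rightarrow> int ^ 'n ^ 'n \<Rightarrow> bool" where
  "extends_matrix Bt B \<longleftrightarrow> (\<forall>i j. Bt (Inl i) j = of_int (B $ i $ j))"

definition ext_exchange_matrix ::
  "real set \<Rightarrow> 'i set \<Rightarrow> ('n::finite, 'i) ext_matrix \<Rightarrow> bool" where
  "ext_exchange_matrix R I Bt \<longleftrightarrow>
     (\<exists>B. exchange_matrix B \<and> extends_matrix Bt B) \<and> (\<forall>i\<in>I. \<forall>j. Bt (Inr i) j \<in> R)"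

definition mutate_matrix :: "'n \<Rightarrow> ('n, 'i) ext_matrix \<Rightarrow> ('n, 'i) ext_matrix" where
  "mutate_matrix k Bt = (\<lambda>i j.
     if i = Inl k \<or> j = k then - Bt i j
     else Bt i j + sgn (Bt (Inl k) j) * max (Bt i k * Bt (Inl k) j) 0)"

definition coefficient :: "'i set \<Rightarrow> ('n, 'i) ext_matrix \<Rightarrow> 'n \<Rightarrow> 'i trop" where
  "coefficient I Bt j = Trop (\<lambda>i. if i \<in> I then Bt (Inr i) j else 0)"

section \<open>The ambient field and seeds\<close>

text \<open>
  \<open>'i trop \<Rightarrow>\<^sub>0 rat\<close> is the rational group ring of \<open>'i trop\<close>, and
  \<open>('n \<Rightarrow>\<^sub>0 nat) \<Rightarrow>\<^sub>0 'i trop \<Rightarrow>\<^sub>0 rat\<close> is the polynomial ring over it in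
  variables indexed by \<open>'n\<close>. For \<open>R\<close> and \<open>I\<close> as above, the group rings of
  \<open>tropical R I\<close> and the field \<open>ratfun_field R I\<close> of rational functions with coefficients in the
  rational group ring of \<open>tropical R I\<close> are subsets of these.
\<close>

type_synonym 'i group_ring = "'i trop \<Rightarrow>\<^sub>0 rat"
type_synonym ('n, 'i) mpoly = "('n \<Rightarrow>\<^sub>0 nat) \<Rightarrow>\<^sub>0 'i group_ring"
type_synonym ('n, 'i) ratfun = "('n, 'i) mpoly fract"

definition QP :: "real set \<Rightarrow> 'i set \<Rightarrow> 'i group_ring set" where
  "QP R I = {c. Poly_Mapping.keys c \<subseteq> tropical R I}"

definition ZP :: "real set \<Rightarrow> 'i set \<Rightarrow> 'i group_ring set" where
  "ZP R I = {c \<in> QP R I. \<forall>a. Poly_Mapping.lookup c a \<in> \<int>}"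

definition mpolys :: "real set \<Rightarrow> 'i set \<Rightarrow> ('n, 'i) mpoly set" where
  "mpolys R I = {p. \<forall>m. Poly_Mapping.lookup p m \<in> QP R I}"

definition ratfun_field ::
  "real set \<Rightarrow> 'i set \<Rightarrow> ('n::{finite,linorder}, 'i) ratfun set" where
  "ratfun_field R I = {Fract p q | p q. p \<in> mpolys R I \<and> q \<in> mpolys R I \<and> q \<noteq> 0}"

definition const_ratfun :: "'i group_ring \<Rightarrow> ('n::{finite,linorder}, 'i) ratfun" where
  "const_ratfun c = Fract (Poly_Mapping.single 0 c) 1"

definition trop_elem :: "'i trop \<Rightarrow> ('n::{finite,linorder}, 'i) ratfun" where
  "trop_elem a = const_ratfun (Poly_Mapping.single a 1)"

definition eval_mpoly ::
  "('n \<Rightarrow> ('n, 'i) ratfun) \<Rightarrow> ('n, 'i) mpoly \<Rightarrow> ('n::{finite,linorder}, 'i) ratfun" where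
  "eval_mpoly x p =
     (\<Sum>m\<in>Poly_Mapping.keys p. const_ratfun (Poly_Mapping.lookup p m) * (\<Prod>j\<in>UNIV. x j ^ Poly_Mapping.lookup m j))"

definition alg_independent ::
  "real set \<Rightarrow> 'i set \<Rightarrow> ('n::{finite,linorder} \<Rightarrow> ('n, 'i) ratfun) \<Rightarrow> bool" where
  "alg_independent R I x \<longleftrightarrow> (\<forall>p\<in>mpolys R I. eval_mpoly x p = 0 \<longrightarrow> p = 0)"

definition generates_field ::
  "real set \<Rightarrow> 'i set \<Rightarrow> ('n::{finite,linorder} \<Rightarrow> ('n, 'i) ratfun) \<Rightarrow> bool" where
  "generates_field R I x \<longleftrightarrow>
     {eval_mpoly x p / eval_mpoly x q | p q.
        p \<in> mpolys R I \<and> q \<in> mpolys R I \<and> eval_mpoly x q \<noteq> 0} = ratfun_field R I"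

type_synonym ('n, 'i) seed = "('n \<Rightarrow> ('n, 'i) ratfun) \<times> ('n, 'i) ext_matrix"

definition is_seed ::
  "real set \<Rightarrow> 'i set \<Rightarrow> ('n::{finite,linorder}, 'i) seed \<Rightarrow> bool" where
  "is_seed R I s \<longleftrightarrow> ext_exchange_matrix R I (snd s) \<and>
     (\<forall>j. fst s j \<in> ratfun_field R I) \<and> alg_independent R I (fst s) \<and> generates_field R I (fst s)"

text \<open>The indeterminates form the cluster of a seed, whatever the extended exchange matrix.\<close>

definition indet :: "'n \<Rightarrow> ('n::{finite,linorder}, 'i) ratfun" where
  "indet j = Fract (Poly_Mapping.single (Poly_Mapping.single j 1) 1) 1"

lemma add_fract_one: "Fract a 1 + Fract b 1 = Fract (a + b) 1"
  by simp

lemma Fract_one_sum: "Fract (sum f A) 1 = (\<Sum>a\<in>A. Fract (f a) 1)"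
  by (induction A rule: infinite_finite_induct) (simp_all add: Zero_fract_def, metis add_fract_one)

lemma indet_power: "indet j ^ e = Fract (Poly_Mapping.single (Poly_Mapping.single j e) 1) 1"
  by (induction e) (simp_all add: indet_def One_fract_def mult_single single_add[symmetric])

lemma Fract_one_prod: "(\<Prod>a\<in>A. Fract (f a) 1) = Fract (prod f A) 1"
  by (induction A rule: infinite_finite_induct) (simp_all add: One_fract_def)

lemma prod_single:
  "(\<Prod>a\<in>A. Poly_Mapping.single (f a) (1 :: 'c::comm_semiring_1)) =
   Poly_Mapping.single (sum f A :: 'b::comm_monoid_add) 1"
  by (induction A rule: infinite_finite_induct) (simp_all add: mult_single)

lemma sum_single_lookup: "(\<Sum>j\<in>UNIV. Poly_Mapping.single j (Poly_Mapping.lookup m j)) = m"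
  for m :: "'n::finite \<Rightarrow>\<^sub>0 nat"
  by (rule poly_mapping_eqI) (simp add: lookup_sum lookup_single when_def)

lemma sum_single_keys:
  "(\<Sum>m\<in>Poly_Mapping.keys p. Poly_Mapping.single m (Poly_Mapping.lookup p m)) = p"
  by (rule poly_mapping_eqI)
     (simp add: lookup_sum lookup_single when_def in_keys_iff)

lemma eval_mpoly_indet: "eval_mpoly indet p = Fract p 1"
proof -
  have "eval_mpoly indet p =
      (\<Sum>m\<in>Poly_Mapping.keys p. Fract (Poly_Mapping.single m (Poly_Mapping.lookup p m)) 1)"
    unfolding eval_mpoly_def const_ratfun_def indet_power Fract_one_prod prod_single sum_single_lookup
    by (simp add: mult_single)
  also have "\<dots> = Fract p 1"
    by (simp only: Fract_one_sum[symmetric] sum_single_keys)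
  finally show ?thesis .
qed

lemma is_seed_indet:
  fixes R :: "real set" and Bt :: "('n::{finite,linorder}, 'i) ext_matrix"
  assumes "underlying_field R" and "ext_exchange_matrix R I Bt"
  shows "is_seed R I (indet, Bt)"
proof -
  have "0 \<in> R"
    using assms(1) unfolding underlying_field_def by (metis Rats_0 subsetD)
  then have z: "0 \<in> tropical R I"
    by (simp add: tropical_def zero_trop_def)
  have "indet j \<in> ratfun_field R I" for j :: 'n
    unfolding indet_def ratfun_field_def mpolys_def QP_def
    by (rule CollectI, intro exI conjI, rule refl)
       (use z in \<open>auto simp: lookup_single when_def lookup_one keys_one\<close>)
  moreover have "alg_independent R I (indet :: 'n \<Rightarrow> ('n, 'i) ratfun)"
    by (simp add: alg_independent_def eval_mpoly_indet Zero_fract_def eq_fract)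
  moreover have "generates_field R I (indet :: 'n \<Rightarrow> ('n, 'i) ratfun)"
    by (simp add: generates_field_def eval_mpoly_indet Zero_fract_def eq_fract ratfun_field_def)
  ultimately show ?thesis
    using assms by (simp add: is_seed_def)
qed

text \<open>
  The entries \<open>Bt (Inl i) k\<close> are integers, and \<open>nat\<close> truncates negative integers to \<open>0\<close>, so
  \<open>nat \<lfloor>b\<rfloor>\<close> is the exponent \<open>max b 0\<close>. The unit of the semifield is \<open>0\<close>.
\<close>

definition mutate_seed ::
  "'i set \<Rightarrow> 'n \<Rightarrow> ('n, 'i) seed \<Rightarrow> ('n::{finite,linorder}, 'i) seed" where
  "mutate_seed I k = (\<lambda>(x, Bt).
     (x(k := (trop_elem (coefficient I Bt k) * (\<Prod>i\<in>UNIV. x i ^ nat \<lfloor>Bt (Inl i) k\<rfloor>)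
               + (\<Prod>i\<in>UNIV. x i ^ nat \<lfloor>- Bt (Inl i) k\<rfloor>))
             / (x k * trop_elem (tplus (coefficient I Bt k) 0))),
      mutate_matrix k Bt))"

text \<open>
  The vertices of the \<open>n\<close>-regular tree are the words over \<open>'n\<close> without equal adjacent
  letters, a word being the sequence of edge labels on the path from the base vertex \<open>[]\<close>; the
  edges labelled \<open>k\<close> join \<open>t\<close> and \<open>t @ [k]\<close>. As seed mutation is involutive, the recursion away
  from the base vertex gives the seed pattern.
\<close>

definition tree_vertices :: "'n list set" where
  "tree_vertices = {t. distinct_adj t}"

definition seed_at ::
  "'i set \<Rightarrow> ('n, 'i) seed \<Rightarrow> 'n list \<Rightarrow> ('n::{finite,linorder}, 'i) seed" where
  "seed_at I s t = fold (mutate_seed I) t s"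

definition cluster_var ::
  "'i set \<Rightarrow> ('n, 'i) seed \<Rightarrow> 'n \<Rightarrow> 'n list \<Rightarrow> ('n::{finite,linorder}, 'i) ratfun" where
  "cluster_var I s j t = fst (seed_at I s t) j"

definition coeff_at ::
  "'i set \<Rightarrow> ('n::{finite,linorder}, 'i) seed \<Rightarrow> 'n \<Rightarrow> 'n list \<Rightarrow> 'i trop" where
  "coeff_at I s j t = coefficient I (snd (seed_at I s t)) j"

section \<open>Cluster algebras and universality\<close>

definition is_subring :: "'a::comm_ring_1 set \<Rightarrow> bool" where
  "is_subring S \<longleftrightarrow> 1 \<in> S \<and> (\<forall>a\<in>S. \<forall>b\<in>S. a - b \<in> S \<and> a * b \<in> S)"

definition cluster_algebra ::
  "real set \<Rightarrow> 'i set \<Rightarrow> ('n, 'i) seed \<Rightarrow> ('n::{finite,linorder}, 'i) ratfun set" where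
  "cluster_algebra R I s =
     is_subring hull (const_ratfun ` ZP R I \<union> {cluster_var I s j t | j t. t \<in> tree_vertices})"

definition ring_hom_on ::
  "'a::comm_ring_1 set \<Rightarrow> 'b::comm_ring_1 set \<Rightarrow> ('a \<Rightarrow> 'b) \<Rightarrow> bool" where
  "ring_hom_on A A' \<phi> \<longleftrightarrow> \<phi> ` A \<subseteq> A' \<and> \<phi> 1 = 1 \<and>
     (\<forall>a\<in>A. \<forall>b\<in>A. \<phi> (a + b) = \<phi> a + \<phi> b \<and> \<phi> (a * b) = \<phi> a * \<phi> b)"

text \<open>\<open>\<psi>\<close> is the restriction of \<open>\<phi>\<close> to the tropical semifield.\<close>

definition coeff_specialization ::
  "real set \<Rightarrow> 'i set \<Rightarrow> ('n::{finite,linorder}, 'i) seed \<Rightarrow> 'j set \<Rightarrow> ('n, 'j) seed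
    \<Rightarrow> (('n, 'i) ratfun \<Rightarrow> ('n, 'j) ratfun) \<Rightarrow> bool" where
  "coeff_specialization R I s I' s' \<phi> \<longleftrightarrow>
     ring_hom_on (cluster_algebra R I s) (cluster_algebra R I' s') \<phi> \<and>
     (\<forall>i j. snd s (Inl i) j = snd s' (Inl i) j) \<and>
     (\<forall>j. \<phi> (fst s j) = fst s' j) \<and>
     (\<exists>\<psi>. (\<forall>a\<in>tropical R I. \<psi> a \<in> tropical R I' \<and> \<phi> (trop_elem a) = trop_elem (\<psi> a)) \<and>
          (\<forall>a\<in>tropical R I. \<forall>b\<in>tropical R I. \<psi> (a + b) = \<psi> a + \<psi> b) \<and>
          (\<forall>c\<in>R. \<forall>a\<in>tropical R I. \<psi> (tscale c a) = tscale c (\<psi> a)) \<and>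
          continuous_map (tropical_topology R I) (tropical_topology R I') \<psi>) \<and>
     (\<forall>j. \<forall>t\<in>tree_vertices.
        \<phi> (trop_elem (coeff_at I s j t)) = trop_elem (coeff_at I' s' j t) \<and>
        \<phi> (trop_elem (tplus (coeff_at I s j t) 0)) = trop_elem (tplus (coeff_at I' s' j t) 0))"

text \<open>
  Uniqueness is meant for maps defined on the cluster algebra only, whence the restriction to
  functions that are \<open>undefined\<close> elsewhere. The first argument gives the type from which the index
  sets of the coefficient rows of the target matrices are taken.
\<close>

definition universal_wrt ::
  "'j itself \<Rightarrow> real set \<Rightarrow> 'i set \<Rightarrow> ('n::{finite,linorder}, 'i) ext_matrix \<Rightarrow> bool" where
  "universal_wrt (_ :: 'j itself) R I Bt \<longleftrightarrow>
     ext_exchange_matrix R I Bt \<and>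
     (\<forall>(I' :: 'j set) Bt' x x'.
        ext_exchange_matrix R I' Bt' \<and> (\<forall>i j. Bt' (Inl i) j = Bt (Inl i) j) \<and>
        is_seed R I (x, Bt) \<and> is_seed R I' (x', Bt') \<longrightarrow>
        (\<exists>!\<phi>. \<phi> \<in> extensional (cluster_algebra R I (x, Bt)) \<and>
              coeff_specialization R I (x, Bt) I' (x', Bt') \<phi>))"

end

theory Submission
  imports Defs
begin

text \<open>
  The exponents of a tropical semifield carry the discrete topology, so a continuous \<open>R\<close>-linear
  map between two tropical semifields is a matrix over \<open>R\<close> each of whose rows has finite support
  (\<open>continuous_linear_finite_expansion\<close>). Seen on coefficients, a coefficient specialization
  therefore writes each coefficient row of the target as a finite linear combination of coefficient
  rows of the source. That it respects \<open>y\<^sub>j\<close> at every vertex of the tree means that the combination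
  survives the simultaneous mutation of all rows along every path; that it respects \<open>y\<^sub>j \<oplus> 1\<close> means
  that it also survives the passage to the parts \<open>min(\<cdot>,0)\<close> of the entries. Call such a combination
  coherent. Being universal then says exactly that the coefficient rows are a basis for coherent
  combinations: spanning gives existence of specializations and independence their uniqueness
  (\<open>universal_wrt_iff_basis\<close>). Being a basis does not refer to the index set of any target, which
  is why universality for one index type implies it for all. Since \<open>R\<close> is a field, a maximal
  independent set of rows spans, and Zorn's lemma provides one (\<open>exists_basis\<close>).

  The converse step, from a matrix of coherent combinations to a ring homomorphism on the cluster
  algebra, goes through the ambient field. As the initial cluster is algebraically
  independent, the pairs \<open>(P(x)/Q(x), P'(x')/Q'(x'))\<close>, where \<open>P', Q'\<close> are the images of \<open>P, Q\<close> under the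
  map of coefficients and \<open>Q'(x') \<noteq> 0\<close>, form the graph of a homomorphism from a local subring of
  the field. This subring is closed under division by each element whose image is not zero.
  Exchange relations divide only by cluster variables and coefficients, so by induction
  along the tree it contains all cluster variables, and they go to those of the target, as soon as the
  latter do not vanish (\<open>coeff_specialization_exists\<close>). The same construction with rational values,
  all coefficients and all initial variables being sent to \<open>1\<close>, shows that they do not: exchange
  relations contain no subtraction, so every cluster variable gets a positive value
  (\<open>cluster_var_nonzero\<close>).
\<close>

section \<open>Evaluation of polynomials over group rings\<close>

text \<open>
  The homomorphism from a monoid ring given by \<open>h\<close> on scalars and by \<open>g\<close> on the monoid. Group
  rings of tropical semifields and polynomial rings over them are both monoid rings, so applying
  this twice evaluates a polynomial and changes its coefficients at the same time.
\<close>

definition pm_eval ::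
  "('c::zero \<Rightarrow> 'f) \<Rightarrow> ('m \<Rightarrow> 'f) \<Rightarrow> ('m \<Rightarrow>\<^sub>0 'c) \<Rightarrow> 'f::comm_ring_1" where
  "pm_eval h g p = (\<Sum>m\<in>Poly_Mapping.keys p. h (Poly_Mapping.lookup p m) * g m)"

lemma pm_eval_superset:
  assumes "h 0 = 0" "finite A" "Poly_Mapping.keys p \<subseteq> A"
  shows "pm_eval h g p = (\<Sum>m\<in>A. h (Poly_Mapping.lookup p m) * g m)"
  unfolding pm_eval_def using assms
  by (intro sum.mono_neutral_left) (auto simp: in_keys_iff)

definition is_ring_hom :: "('a::comm_ring_1 \<Rightarrow> 'b::comm_ring_1) \<Rightarrow> bool" where
  "is_ring_hom h \<longleftrightarrow> h 1 = 1 \<and> (\<forall>a b. h (a + b) = h a + h b \<and> h (a * b) = h a * h b)"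

lemma is_ring_hom_zero: "is_ring_hom h \<Longrightarrow> h 0 = 0"
  by (metis add_0 add_cancel_right_left is_ring_hom_def)

lemma is_ring_hom_diff: "is_ring_hom h \<Longrightarrow> h (a - b) = h a - h b"
  by (metis add_diff_cancel_right' diff_add_cancel is_ring_hom_def)

lemma pm_eval_single: "h 0 = 0 \<Longrightarrow> pm_eval h g (Poly_Mapping.single m c) = h c * g m"
  by (simp add: pm_eval_def)

lemma is_ring_hom_pm_eval:
  fixes g :: "'m::comm_monoid_add \<Rightarrow> 'f::comm_ring_1"
  assumes h: "is_ring_hom h" and g: "g 0 = 1" "\<And>m n. g (m + n) = g m * g n"
  shows "is_ring_hom (pm_eval h g)"
proof -
  note h0 = is_ring_hom_zero[OF h]
  have add: "pm_eval h g (p + q) = pm_eval h g p + pm_eval h g q" for p q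
  proof -
    let ?A = "Poly_Mapping.keys p \<union> Poly_Mapping.keys q"
    have "pm_eval h g r = (\<Sum>m\<in>?A. h (Poly_Mapping.lookup r m) * g m)"
      if "Poly_Mapping.keys r \<subseteq> ?A" for r
      using that by (intro pm_eval_superset h0) auto
    note S = this
    have "pm_eval h g (p + q) = (\<Sum>m\<in>?A. h (Poly_Mapping.lookup (p + q) m) * g m)"
      by (rule S[OF keys_add])
    also have "\<dots> = pm_eval h g p + pm_eval h g q"
      using h by (simp add: S lookup_add is_ring_hom_def distrib_right sum.distrib)
    finally show ?thesis .
  qed
  have zero: "pm_eval h g 0 = 0"
    by (simp add: pm_eval_def)
  have sum: "pm_eval h g (sum f A) = (\<Sum>a\<in>A. pm_eval h g (f a))" for f :: "'m \<Rightarrow> _" and A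
    by (induction A rule: infinite_finite_induct) (simp_all add: add zero)
  have mult: "pm_eval h g (p * q) = pm_eval h g p * pm_eval h g q" for p q
  proof -
    have "p * q = (\<Sum>m\<in>Poly_Mapping.keys p. Poly_Mapping.single m (Poly_Mapping.lookup p m)) *
        (\<Sum>n\<in>Poly_Mapping.keys q. Poly_Mapping.single n (Poly_Mapping.lookup q n))"
      by (simp add: sum_single_keys)
    also have "\<dots> = (\<Sum>m\<in>Poly_Mapping.keys p. \<Sum>n\<in>Poly_Mapping.keys q.
        Poly_Mapping.single (m + n) (Poly_Mapping.lookup p m * Poly_Mapping.lookup q n))"
      by (simp add: sum_product mult_single)
    also have "pm_eval h g \<dots> = pm_eval h g p * pm_eval h g q"
      using h by (simp add: sum pm_eval_single[of h, OF h0] is_ring_hom_def g(2))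
        (simp add: pm_eval_def sum_product mult_ac)
    finally show ?thesis .
  qed
  have "pm_eval h g 1 = 1"
    using h pm_eval_single[of h g 0 1, OF h0] by (simp add: g(1) is_ring_hom_def single_one)
  with add mult show ?thesis
    by (simp add: is_ring_hom_def)
qed

definition monomial_eval :: "('n::finite \<Rightarrow> 'f::comm_ring_1) \<Rightarrow> ('n \<Rightarrow>\<^sub>0 nat) \<Rightarrow> 'f" where
  "monomial_eval x m = (\<Prod>j\<in>UNIV. x j ^ Poly_Mapping.lookup m j)"

lemma monomial_eval_zero: "monomial_eval x 0 = 1"
  by (simp add: monomial_eval_def)

lemma monomial_eval_add: "monomial_eval x (m + n) = monomial_eval x m * monomial_eval x n"
  by (simp add: monomial_eval_def lookup_add power_add prod.distrib)

lemma monomial_eval_single: "monomial_eval x (Poly_Mapping.single k 1) = x k"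
proof -
  have "monomial_eval x (Poly_Mapping.single k 1) = (\<Prod>j\<in>UNIV. if j = k then x j else 1)"
    unfolding monomial_eval_def by (intro prod.cong) (auto simp: lookup_single when_def)
  then show ?thesis by simp
qed

lemma eval_mpoly_eq_pm_eval: "eval_mpoly x = pm_eval const_ratfun (monomial_eval x)"
  by (simp add: fun_eq_iff eval_mpoly_def pm_eval_def monomial_eval_def)

lemma is_ring_hom_const_ratfun: "is_ring_hom const_ratfun"
  by (simp add: is_ring_hom_def const_ratfun_def One_fract_def single_add mult_single)

lemma is_ring_hom_eval_mpoly: "is_ring_hom (eval_mpoly x)"
  unfolding eval_mpoly_eq_pm_eval
  by (intro is_ring_hom_pm_eval is_ring_hom_const_ratfun monomial_eval_zero monomial_eval_add)

lemma trop_elem_add: "trop_elem (a + b) = trop_elem a * trop_elem b"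
proof -
  have "Poly_Mapping.single (a + b) 1 = Poly_Mapping.single a 1 * Poly_Mapping.single b (1::rat)"
    by (simp add: mult_single)
  then show ?thesis
    unfolding trop_elem_def using is_ring_hom_const_ratfun by (metis is_ring_hom_def)
qed

lemma trop_elem_zero: "trop_elem 0 = 1"
  by (simp add: trop_elem_def const_ratfun_def One_fract_def)

lemma trop_elem_nonzero: "trop_elem a \<noteq> 0"
  by (metis add.right_inverse mult_zero_left trop_elem_add trop_elem_zero zero_neq_one)

lemma single_one_ne: "Poly_Mapping.single a (1::'c::zero_neq_one) = Poly_Mapping.single b 1 \<longleftrightarrow> a = b"
  by (metis keys_single singleton_inject zero_neq_one)

lemma trop_elem_inj: "trop_elem a = trop_elem b \<longleftrightarrow> a = b"
  by (auto simp: trop_elem_def const_ratfun_def eq_fract) (metis (no_types) lookup_single_eq single_one_ne)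

section \<open>Tropical semifields and their group rings\<close>

lemma underlying_fieldD:
  assumes "underlying_field R"
  shows "0 \<in> R" "1 \<in> R" "of_int k \<in> R" "a \<in> R \<Longrightarrow> b \<in> R \<Longrightarrow> a + b \<in> R"
    "a \<in> R \<Longrightarrow> b \<in> R \<Longrightarrow> a * b \<in> R" "a \<in> R \<Longrightarrow> - a \<in> R" "a \<in> R \<Longrightarrow> inverse a \<in> R"
    "a \<in> R \<Longrightarrow> b \<in> R \<Longrightarrow> a - b \<in> R"
proof -
  have Q: "\<rat> \<subseteq> R" using assms by (simp add: underlying_field_def)
  then show "0 \<in> R" "1 \<in> R" "of_int k \<in> R" by auto
  show *: "a \<in> R \<Longrightarrow> b \<in> R \<Longrightarrow> a + b \<in> R" "a \<in> R \<Longrightarrow> b \<in> R \<Longrightarrow> a * b \<in> R" "a \<in> R \<Longrightarrow> - a \<in> R"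
    "a \<in> R \<Longrightarrow> inverse a \<in> R" for a b
    using assms by (auto simp: underlying_field_def)
  show "a \<in> R \<Longrightarrow> b \<in> R \<Longrightarrow> a - b \<in> R"
    using *(1)[of a "- b"] *(3)[of b] by simp
qed

lemma underlying_field_sum:
  assumes "underlying_field R" "\<And>i. i \<in> S \<Longrightarrow> f i \<in> R"
  shows "sum f S \<in> R"
  using assms(2) by (induction S rule: infinite_finite_induct) (auto intro: underlying_fieldD[OF assms(1)])

lemma texp_simps [simp]:
  "texp 0 i = 0" "texp (a + b) i = texp a i + texp b i" "texp (- a) i = - texp a i"
  "texp (a - b) i = texp a i - texp b i" "texp (tplus a b) i = min (texp a i) (texp b i)"
  "texp (tscale c a) i = c * texp a i"
  by (simp_all add: zero_trop_def plus_trop_def uminus_trop_def minus_trop_def tplus_def tscale_def)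

lemma tropical_zero: "underlying_field R \<Longrightarrow> 0 \<in> tropical R I"
  by (simp add: tropical_def underlying_fieldD)

lemma tropical_add: "underlying_field R \<Longrightarrow> a \<in> tropical R I \<Longrightarrow> b \<in> tropical R I \<Longrightarrow> a + b \<in> tropical R I"
  by (auto simp: tropical_def intro: underlying_fieldD(4))

lemma tropical_tplus:
  "a \<in> tropical R I \<Longrightarrow> b \<in> tropical R I \<Longrightarrow> tplus a b \<in> tropical R I"
  by (auto simp: tropical_def min_def)

text \<open>
  With \<open>C\<close> the group ring of a tropical semifield, this makes \<open>mpolys R I\<close> closed under
  multiplication, so that algebraic independence can be applied after clearing denominators.
\<close>

lemma pm_mult_coeffs:
  fixes p q :: "'m::comm_monoid_add \<Rightarrow>\<^sub>0 'c::comm_ring_1"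
  assumes C: "0 \<in> C" "\<And>a b. a \<in> C \<Longrightarrow> b \<in> C \<Longrightarrow> a + b \<in> C" "\<And>a b. a \<in> C \<Longrightarrow> b \<in> C \<Longrightarrow> a * b \<in> C"
    and p: "\<And>m. Poly_Mapping.lookup p m \<in> C" and q: "\<And>m. Poly_Mapping.lookup q m \<in> C"
  shows "Poly_Mapping.lookup (p * q) m \<in> C"
proof -
  have sum: "sum f A \<in> C" if "\<And>a. a \<in> A \<Longrightarrow> f a \<in> C" for f :: "'m \<Rightarrow> 'c" and A
    using that by (induction A rule: infinite_finite_induct) (auto intro: C)
  have "p * q = (\<Sum>m\<in>Poly_Mapping.keys p. Poly_Mapping.single m (Poly_Mapping.lookup p m)) *
      (\<Sum>n\<in>Poly_Mapping.keys q. Poly_Mapping.single n (Poly_Mapping.lookup q n))"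
    by (simp add: sum_single_keys)
  also have "\<dots> = (\<Sum>m\<in>Poly_Mapping.keys p. \<Sum>n\<in>Poly_Mapping.keys q.
      Poly_Mapping.single (m + n) (Poly_Mapping.lookup p m * Poly_Mapping.lookup q n))"
    by (simp add: sum_product mult_single)
  finally have "p * q = \<dots>" .
  moreover have "Poly_Mapping.lookup \<dots> m \<in> C"
    unfolding lookup_sum by (intro sum) (auto simp: lookup_single when_def intro: C p q)
  ultimately show ?thesis by simp
qed

context
  fixes R :: "real set"
  assumes R: "underlying_field R"
begin

lemma QP_single: "a \<in> tropical R I \<Longrightarrow> Poly_Mapping.single a r \<in> QP R I"
  by (auto simp: QP_def)

lemma QP_zero: "0 \<in> QP R I"
  by (simp add: QP_def)

lemma QP_add: "c \<in> QP R I \<Longrightarrow> d \<in> QP R I \<Longrightarrow> c + d \<in> QP R I"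
  using keys_add[of c d] by (auto simp: QP_def)

lemma QP_diff: "c \<in> QP R I \<Longrightarrow> d \<in> QP R I \<Longrightarrow> c - d \<in> QP R I"
  using keys_diff[of c d] by (auto simp: QP_def)

lemma QP_mult: "c \<in> QP R I \<Longrightarrow> d \<in> QP R I \<Longrightarrow> c * d \<in> QP R I"
  using keys_mult[of c d] tropical_add[OF R] by (fastforce simp: QP_def)

lemma mpolys_single: "c \<in> QP R I \<Longrightarrow> Poly_Mapping.single m c \<in> mpolys R I"
  by (auto simp: mpolys_def lookup_single when_def QP_zero)

lemma mpolys_one: "1 \<in> mpolys R I"
  using mpolys_single[OF QP_single[OF tropical_zero[OF R]], of 0 1] by simp

lemma mpolys_diff: "p \<in> mpolys R I \<Longrightarrow> q \<in> mpolys R I \<Longrightarrow> p - q \<in> mpolys R I"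
  by (simp add: mpolys_def lookup_minus QP_diff)

lemma mpolys_mult: "p \<in> mpolys R I \<Longrightarrow> q \<in> mpolys R I \<Longrightarrow> p * q \<in> mpolys R I"
  unfolding mpolys_def mem_Collect_eq
  by (intro allI pm_mult_coeffs QP_zero QP_add QP_mult) auto

end

section \<open>Seeds along the tree\<close>

lemma seed_at_snoc: "seed_at I s (t @ [k]) = mutate_seed I k (seed_at I s t)"
  by (simp add: seed_at_def)

lemma snd_seed_at: "snd (seed_at I s t) = fold mutate_matrix t (snd s)"
  by (induction t rule: rev_induct)
    (simp_all add: seed_at_def mutate_seed_def case_prod_beta)

lemma coeff_at_eq: "coeff_at I s j t = coefficient I (fold mutate_matrix t (snd s)) j"
  by (simp add: coeff_at_def snd_seed_at)

lemma cluster_var_Nil: "cluster_var I s j [] = fst s j"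
  by (simp add: cluster_var_def seed_at_def)

lemma cluster_var_snoc:
  "cluster_var I s j (t @ [k]) = (if j = k then
     (trop_elem (coeff_at I s k t) *
        (\<Prod>i\<in>UNIV. cluster_var I s i t ^ nat \<lfloor>fold mutate_matrix t (snd s) (Inl i) k\<rfloor>)
      + (\<Prod>i\<in>UNIV. cluster_var I s i t ^ nat \<lfloor>- fold mutate_matrix t (snd s) (Inl i) k\<rfloor>))
     / (cluster_var I s k t * trop_elem (tplus (coeff_at I s k t) 0))
   else cluster_var I s j t)"
  by (simp add: cluster_var_def seed_at_snoc mutate_seed_def case_prod_beta coeff_at_def snd_seed_at)

lemma tree_vertices_Nil: "[] \<in> tree_vertices"
  by (simp add: tree_vertices_def)

lemma tree_vertices_snocD: "t @ [k] \<in> tree_vertices \<Longrightarrow> t \<in> tree_vertices"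
  by (auto simp: tree_vertices_def)

text \<open>
  Reduced words are closed under removing the last letter, so a statement on all vertices follows
  by moving away from the base vertex, the direction in which seeds are defined.
\<close>

lemma tree_vertices_induct [consumes 1, case_names Nil snoc]:
  assumes "t \<in> tree_vertices" "P []"
    "\<And>t k. t \<in> tree_vertices \<Longrightarrow> t @ [k] \<in> tree_vertices \<Longrightarrow> P t \<Longrightarrow> P (t @ [k])"
  shows "P t"
  using assms(1)
proof (induction t rule: rev_induct)
  case (snoc k t)
  then show ?case using assms(3)[of t k] tree_vertices_snocD[of t k] by simp
qed (rule assms(2))

text \<open>
  A mutated entry arises from old ones by ring operations, \<open>max \<cdot> 0\<close> and signs, none of which leads
  out of \<open>R\<close>.
\<close>

lemma fold_mutate_matrix_mem:
  assumes R: "underlying_field R"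
    and "\<forall>i j. (Bt :: ('n, 'i) ext_matrix) (Inl i) j \<in> R" "\<forall>i\<in>I. \<forall>j. Bt (Inr i) j \<in> R"
  shows "(\<forall>i j. fold mutate_matrix t Bt (Inl i) j \<in> R) \<and>
    (\<forall>i\<in>I. \<forall>j. fold mutate_matrix t Bt (Inr i) j \<in> R)"
proof (induction t rule: rev_induct)
  case (snoc k t)
  have "sgn a \<in> R" for a :: real
    by (auto simp: sgn_if intro: underlying_fieldD[OF R])
  moreover have "max a 0 \<in> R" if "a \<in> R" for a :: real
    using that underlying_fieldD(1)[OF R] by (simp add: max_def)
  ultimately have "mutate_matrix k M r j \<in> R"
    if "M r j \<in> R" "M r k \<in> R" "M (Inl k) j \<in> R" for M :: "('n, 'i) ext_matrix" and r j
    unfolding mutate_matrix_def using that by (simp add: underlying_fieldD(4,5,6)[OF R])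
  then show ?case using snoc by simp
qed (use assms in auto)

lemma ext_exchange_matrix_mem:
  assumes "underlying_field R" "ext_exchange_matrix R I Bt"
  shows "Bt (Inl k) j \<in> R" "i \<in> I \<Longrightarrow> Bt (Inr i) j \<in> R"
    "i \<in> I \<Longrightarrow> fold mutate_matrix t Bt (Inr i) j \<in> R"
proof -
  show *: "Bt (Inl k) j \<in> R" "i \<in> I \<Longrightarrow> Bt (Inr i) j \<in> R" for k i j
    using assms by (auto simp: ext_exchange_matrix_def extends_matrix_def intro: underlying_fieldD(3))
  show "i \<in> I \<Longrightarrow> fold mutate_matrix t Bt (Inr i) j \<in> R"
    using fold_mutate_matrix_mem[OF assms(1), of Bt I t] * by blast
qed

lemma coeff_at_tropical:
  assumes "underlying_field R" "ext_exchange_matrix R I (snd s)"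
  shows "coeff_at I s j t \<in> tropical R I"
  using ext_exchange_matrix_mem(3)[OF assms]
  by (auto simp: coeff_at_eq coefficient_def tropical_def)

section \<open>Cluster algebras as subrings\<close>

lemma is_subringD:
  assumes "is_subring S"
  shows "1 \<in> S" "a \<in> S \<Longrightarrow> b \<in> S \<Longrightarrow> a - b \<in> S" "a \<in> S \<Longrightarrow> b \<in> S \<Longrightarrow> a * b \<in> S" "0 \<in> S"
    "a \<in> S \<Longrightarrow> - a \<in> S" "a \<in> S \<Longrightarrow> b \<in> S \<Longrightarrow> a + b \<in> S" "of_int k \<in> S" "a \<in> S \<Longrightarrow> a ^ e \<in> S"
proof -
  show [intro]: "1 \<in> S" "\<And>a b. a \<in> S \<Longrightarrow> b \<in> S \<Longrightarrow> a - b \<in> S" "\<And>a b. a \<in> S \<Longrightarrow> b \<in> S \<Longrightarrow> a * b \<in> S"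
    using assms by (auto simp: is_subring_def)
  show zero [intro]: "0 \<in> S"
    using \<open>1 \<in> S\<close> \<open>\<And>a b. a \<in> S \<Longrightarrow> b \<in> S \<Longrightarrow> a - b \<in> S\<close>[of 1 1] by simp
  show uminus [intro]: "- a \<in> S" if "a \<in> S" for a
    using \<open>\<And>a b. a \<in> S \<Longrightarrow> b \<in> S \<Longrightarrow> a - b \<in> S\<close>[of 0 a] that zero by simp
  show add [intro]: "a + b \<in> S" if "a \<in> S" "b \<in> S" for a b
    using \<open>\<And>a b. a \<in> S \<Longrightarrow> b \<in> S \<Longrightarrow> a - b \<in> S\<close>[of a "- b"] that by auto
  show "of_int k \<in> S"
    by (induction k rule: int_induct[where k = 0]) auto
  show "a \<in> S \<Longrightarrow> a ^ e \<in> S"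
    by (induction e) auto
qed

lemma is_subring_sum:
  assumes "is_subring S" "\<And>i. i \<in> A \<Longrightarrow> f i \<in> S"
  shows "sum f A \<in> S"
  using assms(2)
  by (induction A rule: infinite_finite_induct) (auto intro: is_subringD[OF assms(1)])

lemma is_subring_prod:
  assumes "is_subring S" "\<And>i. i \<in> A \<Longrightarrow> f i \<in> S"
  shows "prod f A \<in> S"
  using assms(2)
  by (induction A rule: infinite_finite_induct) (auto intro: is_subringD[OF assms(1)])

lemma is_subring_cluster_algebra: "is_subring (cluster_algebra R I s)"
  unfolding cluster_algebra_def by (rule hull_in) (auto simp: is_subring_def)

lemma const_ratfun_simps:
  "const_ratfun 0 = 0" "const_ratfun 1 = 1" "const_ratfun (a + b) = const_ratfun a + const_ratfun b"
  "const_ratfun (a - b) = const_ratfun a - const_ratfun b"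
  "const_ratfun (a * b) = const_ratfun a * const_ratfun b"
  using is_ring_hom_const_ratfun is_ring_hom_zero[OF is_ring_hom_const_ratfun]
    is_ring_hom_diff[OF is_ring_hom_const_ratfun] unfolding is_ring_hom_def by blast+

lemma const_ratfun_single:
  "const_ratfun (Poly_Mapping.single a (of_int k)) = of_int k * trop_elem a"
  by (induction k rule: int_induct[where k = 0])
    (simp_all add: single_add single_diff const_ratfun_simps trop_elem_def algebra_simps)

text \<open>
  Integers lie in every subring, so as a ring the cluster algebra is already generated by the
  tropical elements and the cluster variables. Homomorphisms on it need only be examined there.
\<close>

lemma const_ratfun_ZP_mem:
  assumes S: "is_subring S" and t: "\<And>a. a \<in> tropical R I \<Longrightarrow> trop_elem a \<in> S" and c: "c \<in> ZP R I"
  shows "const_ratfun c \<in> S"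
proof -
  have sum: "const_ratfun (sum f A) = (\<Sum>a\<in>A. const_ratfun (f a))"
    for f :: "'i trop \<Rightarrow> 'i group_ring" and A
    by (induction A rule: infinite_finite_induct) (auto simp: const_ratfun_simps)
  have "const_ratfun c = (\<Sum>a\<in>Poly_Mapping.keys c.
      const_ratfun (Poly_Mapping.single a (Poly_Mapping.lookup c a)))"
    by (simp add: sum[symmetric] sum_single_keys)
  also have "\<dots> \<in> S"
  proof (intro is_subring_sum[OF S])
    fix a assume a: "a \<in> Poly_Mapping.keys c"
    obtain k where "Poly_Mapping.lookup c a = of_int k"
      using c by (auto simp: ZP_def elim: Ints_cases)
    moreover have "a \<in> tropical R I"
      using a c by (auto simp: ZP_def QP_def)
    ultimately show "const_ratfun (Poly_Mapping.single a (Poly_Mapping.lookup c a)) \<in> S"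
      by (simp add: const_ratfun_single is_subringD[OF S] t)
  qed
  finally show ?thesis .
qed

lemma trop_elem_mem_cluster_algebra:
  "a \<in> tropical R I \<Longrightarrow> trop_elem a \<in> cluster_algebra R I s"
  unfolding cluster_algebra_def trop_elem_def
  by (rule hull_inc) (auto simp: ZP_def QP_def lookup_single when_def)

lemma cluster_var_mem_cluster_algebra:
  "t \<in> tree_vertices \<Longrightarrow> cluster_var I s j t \<in> cluster_algebra R I s"
  unfolding cluster_algebra_def by (rule hull_inc) auto

lemma cluster_algebra_subset:
  assumes "is_subring S" "\<And>a. a \<in> tropical R I \<Longrightarrow> trop_elem a \<in> S"
    "\<And>j t. t \<in> tree_vertices \<Longrightarrow> cluster_var I s j t \<in> S"
  shows "cluster_algebra R I s \<subseteq> S"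
  unfolding cluster_algebra_def
  by (rule hull_minimal) (use assms const_ratfun_ZP_mem[OF assms(1,2)] in auto)

section \<open>Specializing rational functions\<close>

text \<open>
  The data \<open>h\<close>, \<open>g\<close>, \<open>z\<close> prescribe the images of rational scalars, of tropical elements and of the
  cluster \<open>x\<close> in a field. They define a homomorphism on polynomials in \<open>x\<close>, which may have a
  kernel, and hence one on the fractions whose denominator avoids the kernel. The target field is kept
  general because it is used both for the field of another seed and for the rational numbers.
\<close>

locale ratfun_specialization =
  fixes R :: "real set" and I :: "'i set"
    and x :: "'n::{finite,linorder} \<Rightarrow> ('n, 'i) ratfun"
    and h :: "rat \<Rightarrow> 'f::field" and g :: "'i trop \<Rightarrow> 'f" and z :: "'n \<Rightarrow> 'f"
  assumes R: "underlying_field R" and indep: "alg_independent R I x"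
    and h: "is_ring_hom h" and g_zero: "g 0 = 1" and g_add: "g (a + b) = g a * g b"
begin

definition coeff_image :: "'i group_ring \<Rightarrow> 'f" where
  "coeff_image = pm_eval h g"

definition poly_image :: "('n, 'i) mpoly \<Rightarrow> 'f" where
  "poly_image = pm_eval coeff_image (monomial_eval z)"

lemma coeff_image_hom: "is_ring_hom coeff_image"
  unfolding coeff_image_def by (intro is_ring_hom_pm_eval h g_zero g_add)

lemma poly_image_hom: "is_ring_hom poly_image"
  unfolding poly_image_def
  by (intro is_ring_hom_pm_eval coeff_image_hom monomial_eval_zero monomial_eval_add)

text \<open>
  The homomorphism on fractions is kept as a relation: it is partial, and as a relation it can be
  combined by ring operations without reference to chosen numerators and denominators.
\<close>

definition graph :: "(('n, 'i) ratfun \<times> 'f) set" where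
  "graph = {(eval_mpoly x p / eval_mpoly x q, poly_image p / poly_image q) | p q.
     p \<in> mpolys R I \<and> q \<in> mpolys R I \<and> poly_image q \<noteq> 0}"

lemma graphI:
  assumes "p \<in> mpolys R I" "q \<in> mpolys R I" "poly_image q \<noteq> 0"
    "a = eval_mpoly x p / eval_mpoly x q" "b = poly_image p / poly_image q"
  shows "(a, b) \<in> graph"
  using assms unfolding graph_def by blast

lemma graphE:
  assumes "(a, b) \<in> graph"
  obtains p q where "p \<in> mpolys R I" "q \<in> mpolys R I" "poly_image q \<noteq> 0" "eval_mpoly x q \<noteq> 0"
    "a = eval_mpoly x p / eval_mpoly x q" "b = poly_image p / poly_image q"
proof -
  obtain p q where pq: "p \<in> mpolys R I" "q \<in> mpolys R I" "poly_image q \<noteq> 0"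
    "a = eval_mpoly x p / eval_mpoly x q" "b = poly_image p / poly_image q"
    using assms unfolding graph_def by blast
  moreover have "eval_mpoly x q \<noteq> 0"
    using indep pq(2,3) is_ring_hom_zero[OF poly_image_hom] by (auto simp: alg_independent_def)
  ultimately show ?thesis using that by blast
qed

text \<open>
  Equal fractions have equal cross products in the ambient field, hence, by algebraic independence
  of \<open>x\<close>, equal cross products as polynomials, and these have equal images.
\<close>

lemma graph_unique:
  assumes "(a, b) \<in> graph" "(a, b') \<in> graph"
  shows "b = b'"
proof -
  note hom = is_ring_hom_eval_mpoly[of x, unfolded is_ring_hom_def]
    poly_image_hom[unfolded is_ring_hom_def]
    is_ring_hom_diff[OF is_ring_hom_eval_mpoly[of x]] is_ring_hom_diff[OF poly_image_hom]
  obtain p q where pq: "p \<in> mpolys R I" "q \<in> mpolys R I" "poly_image q \<noteq> 0" "eval_mpoly x q \<noteq> 0"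
    "a = eval_mpoly x p / eval_mpoly x q" "b = poly_image p / poly_image q"
    using assms(1) by (rule graphE)
  obtain p' q' where pq': "p' \<in> mpolys R I" "q' \<in> mpolys R I" "poly_image q' \<noteq> 0"
    "eval_mpoly x q' \<noteq> 0" "a = eval_mpoly x p' / eval_mpoly x q'" "b' = poly_image p' / poly_image q'"
    using assms(2) by (rule graphE)
  have "eval_mpoly x (p * q' - p' * q) = 0"
    using pq(4,5) pq'(4,5) by (simp add: hom frac_eq_eq)
  moreover have "p * q' - p' * q \<in> mpolys R I"
    by (intro mpolys_diff mpolys_mult R pq pq')
  ultimately have "p * q' - p' * q = 0"
    using indep by (auto simp: alg_independent_def)
  then have "poly_image (p * q' - p' * q) = 0"
    using is_ring_hom_zero[OF poly_image_hom] by simp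
  then show ?thesis
    using pq pq' by (simp add: hom frac_eq_eq)
qed

lemma graph_eval:
  assumes "p \<in> mpolys R I"
  shows "(eval_mpoly x p, poly_image p) \<in> graph"
  by (rule graphI[of p 1])
    (use assms mpolys_one[OF R] is_ring_hom_eval_mpoly[of x] poly_image_hom in \<open>auto simp: is_ring_hom_def\<close>)

lemma graph_trop_elem:
  assumes "a \<in> tropical R I"
  shows "(trop_elem a, g a) \<in> graph"
proof -
  let ?p = "Poly_Mapping.single 0 (Poly_Mapping.single a 1)"
  have "eval_mpoly x ?p = trop_elem a"
    by (simp add: eval_mpoly_eq_pm_eval pm_eval_single is_ring_hom_zero is_ring_hom_const_ratfun
        monomial_eval_zero trop_elem_def)
  moreover have "poly_image ?p = g a"
    using h by (simp add: poly_image_def pm_eval_single is_ring_hom_zero coeff_image_hom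
        monomial_eval_zero) (simp add: coeff_image_def pm_eval_single is_ring_hom_zero is_ring_hom_def)
  moreover have "?p \<in> mpolys R I"
    by (intro mpolys_single QP_single R assms)
  ultimately show ?thesis using graph_eval[of ?p] by simp
qed

lemma graph_var: "(x j, z j) \<in> graph"
proof -
  let ?p = "Poly_Mapping.single (Poly_Mapping.single j 1) 1"
  have "eval_mpoly x ?p = x j"
    by (simp only: eval_mpoly_eq_pm_eval pm_eval_single const_ratfun_simps monomial_eval_single mult_1)
  moreover have "coeff_image 1 = 1"
    using coeff_image_hom by (simp add: is_ring_hom_def)
  then have "poly_image ?p = z j"
    by (simp only: poly_image_def pm_eval_single is_ring_hom_zero[OF coeff_image_hom]
        monomial_eval_single mult_1)
  moreover have "?p \<in> mpolys R I"
    using mpolys_single[OF R QP_single[OF R tropical_zero[OF R]], of _ 1] by simp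
  ultimately show ?thesis using graph_eval[of ?p] by simp
qed

lemma graph_one: "(1, 1) \<in> graph"
  using graph_trop_elem[OF tropical_zero[OF R]] by (simp add: trop_elem_zero g_zero)

lemma graph_diff:
  assumes "(a, b) \<in> graph" "(c, d) \<in> graph"
  shows "(a - c, b - d) \<in> graph"
proof -
  note hom = is_ring_hom_eval_mpoly[of x, unfolded is_ring_hom_def]
    poly_image_hom[unfolded is_ring_hom_def]
    is_ring_hom_diff[OF is_ring_hom_eval_mpoly[of x]] is_ring_hom_diff[OF poly_image_hom]
  obtain p q where pq: "p \<in> mpolys R I" "q \<in> mpolys R I" "poly_image q \<noteq> 0" "eval_mpoly x q \<noteq> 0"
    "a = eval_mpoly x p / eval_mpoly x q" "b = poly_image p / poly_image q"
    using assms(1) by (rule graphE)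
  obtain p' q' where pq': "p' \<in> mpolys R I" "q' \<in> mpolys R I" "poly_image q' \<noteq> 0"
    "eval_mpoly x q' \<noteq> 0" "c = eval_mpoly x p' / eval_mpoly x q'" "d = poly_image p' / poly_image q'"
    using assms(2) by (rule graphE)
  show ?thesis
    by (rule graphI[of "p * q' - p' * q" "q * q'"])
      (use pq pq' in \<open>auto simp: hom diff_frac_eq intro: mpolys_diff[OF R] mpolys_mult[OF R]\<close>)
qed

text \<open>
  The domain is the localization of the polynomial ring at the kernel of \<open>poly_image\<close>, a prime
  ideal: a fraction with nonzero image has numerator outside the kernel and is a unit.
\<close>

lemma graph_divide:
  assumes "(a, b) \<in> graph" "(c, d) \<in> graph" "d \<noteq> 0"
  shows "(a / c, b / d) \<in> graph"
proof -
  note hom = is_ring_hom_eval_mpoly[of x, unfolded is_ring_hom_def]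
    poly_image_hom[unfolded is_ring_hom_def]
  obtain p q where pq: "p \<in> mpolys R I" "q \<in> mpolys R I" "poly_image q \<noteq> 0" "eval_mpoly x q \<noteq> 0"
    "a = eval_mpoly x p / eval_mpoly x q" "b = poly_image p / poly_image q"
    using assms(1) by (rule graphE)
  obtain p' q' where pq': "p' \<in> mpolys R I" "q' \<in> mpolys R I" "poly_image q' \<noteq> 0"
    "eval_mpoly x q' \<noteq> 0" "c = eval_mpoly x p' / eval_mpoly x q'" "d = poly_image p' / poly_image q'"
    using assms(2) by (rule graphE)
  show ?thesis
    by (rule graphI[of "p * q'" "q * p'"])
      (use pq pq' assms(3) in \<open>auto simp: hom intro: mpolys_mult[OF R]\<close>)
qed

lemma graph_mult:
  assumes "(a, b) \<in> graph" "(c, d) \<in> graph"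
  shows "(a * c, b * d) \<in> graph"
proof -
  note hom = is_ring_hom_eval_mpoly[of x, unfolded is_ring_hom_def]
    poly_image_hom[unfolded is_ring_hom_def]
  obtain p q where pq: "p \<in> mpolys R I" "q \<in> mpolys R I" "poly_image q \<noteq> 0" "eval_mpoly x q \<noteq> 0"
    "a = eval_mpoly x p / eval_mpoly x q" "b = poly_image p / poly_image q"
    using assms(1) by (rule graphE)
  obtain p' q' where pq': "p' \<in> mpolys R I" "q' \<in> mpolys R I" "poly_image q' \<noteq> 0"
    "eval_mpoly x q' \<noteq> 0" "c = eval_mpoly x p' / eval_mpoly x q'" "d = poly_image p' / poly_image q'"
    using assms(2) by (rule graphE)
  show ?thesis
    by (rule graphI[of "p * p'" "q * q'"])
      (use pq pq' in \<open>auto simp: hom intro: mpolys_mult[OF R]\<close>)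
qed

lemma graph_zero: "(0, 0) \<in> graph"
  using graph_diff[OF graph_one graph_one] by simp

lemma graph_add:
  assumes "(a, b) \<in> graph" "(c, d) \<in> graph"
  shows "(a + c, b + d) \<in> graph"
  using graph_diff[OF assms(1) graph_diff[OF graph_zero assms(2)]] by simp

lemma graph_monomial:
  assumes "\<And>j. (X j, Y j) \<in> graph"
  shows "((\<Prod>j\<in>A. X j ^ e j), (\<Prod>j\<in>A. Y j ^ e j)) \<in> graph"
proof -
  have "(X j ^ e', Y j ^ e') \<in> graph" for j e'
    by (induction e') (simp_all add: graph_one graph_mult assms)
  then show ?thesis
    by (induction A rule: infinite_finite_induct) (simp_all add: graph_one graph_mult)
qed

text \<open>
  The inductive step along the tree. Tropical elements are units, so only the cluster variable in
  the denominator can obstruct the division.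
\<close>

lemma graph_exchange:
  assumes XY: "\<And>j. (X j, Y j) \<in> graph" and "Y k \<noteq> 0" and y: "y \<in> tropical R I"
  shows "((trop_elem y * (\<Prod>j\<in>UNIV. X j ^ e j) + (\<Prod>j\<in>UNIV. X j ^ f j)) / (X k * trop_elem (tplus y 0)),
    (g y * (\<Prod>j\<in>UNIV. Y j ^ e j) + (\<Prod>j\<in>UNIV. Y j ^ f j)) / (Y k * g (tplus y 0))) \<in> graph"
proof -
  have "g a \<noteq> 0" for a
    using g_add[of a "- a"] by (auto simp: g_zero)
  then show ?thesis
    using assms(2) tropical_tplus[OF y tropical_zero[OF R]]
    by (intro graph_divide graph_add graph_mult graph_monomial graph_trop_elem XY y) auto
qed

end

text \<open>
  Sending all tropical elements and all initial variables to \<open>1\<close> gives every cluster variable a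
  positive rational value, because exchange relations involve only sums, products and quotients.
  The element \<open>0\<close> has value \<open>0\<close>.
\<close>

lemma cluster_var_nonzero:
  fixes s :: "('n::{finite,linorder}, 'i) seed"
  assumes R: "underlying_field R" and s: "is_seed R I s"
  shows "cluster_var I s k t \<noteq> 0"
proof -
  interpret ratfun_specialization R I "fst s" "\<lambda>r. r" "\<lambda>_. 1" "\<lambda>_. 1 :: rat"
    using s by unfold_locales (auto simp: R is_seed_def is_ring_hom_def)
  have "\<exists>r. \<forall>j. (cluster_var I s j t, r j) \<in> graph \<and> 0 < r j"
  proof (induction t rule: rev_induct)
    case Nil
    show ?case
      by (rule exI[of _ "\<lambda>_. 1"]) (simp add: cluster_var_Nil graph_var)
  next
    case (snoc k t)
    then obtain r where r: "(cluster_var I s j t, r j) \<in> graph" "0 < r j" for j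
      by blast
    let ?M = "fold mutate_matrix t (snd s)"
    let ?r = "r(k := (1 * (\<Prod>i\<in>UNIV. r i ^ nat \<lfloor>?M (Inl i) k\<rfloor>) +
        (\<Prod>i\<in>UNIV. r i ^ nat \<lfloor>- ?M (Inl i) k\<rfloor>)) / (r k * 1))"
    have "coeff_at I s k t \<in> tropical R I"
      using s by (intro coeff_at_tropical R) (simp add: is_seed_def)
    moreover have "r k \<noteq> 0" using r(2)[of k] by simp
    ultimately have "(cluster_var I s j (t @ [k]), ?r j) \<in> graph" for j
      using graph_exchange[of "\<lambda>j. cluster_var I s j t" r k, OF r(1)] r(1)
      by (simp add: cluster_var_snoc)
    moreover have "0 < ?r j" for j
      using r(2) by (simp add: divide_pos_pos add_pos_pos prod_pos)
    ultimately show ?case by (intro exI[of _ ?r]) blast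
  qed
  then obtain r where "(cluster_var I s k t, r) \<in> graph" "0 < r"
    by blast
  then show ?thesis
    using graph_unique[OF graph_zero, of r] by auto
qed

section \<open>Coherent linear relations among coefficient rows\<close>

text \<open>
  Mutation changes a coefficient row in a way that depends only on that row and on the exchange
  matrix. The auxiliary matrix has a single coefficient row, indexed by the element of \<open>unit\<close>. As a
  function of \<open>v\<close> this is the mutation map of the exchange matrix along the path \<open>t\<close>; it is
  piecewise linear, so that linear relations among rows are in general not preserved.
\<close>

definition mutated_row :: "('n \<Rightarrow> 'n \<Rightarrow> real) \<Rightarrow> 'n list \<Rightarrow> ('n \<Rightarrow> real) \<Rightarrow> 'n \<Rightarrow> real" where
  "mutated_row M t v = fold mutate_matrix t (case_sum M (\<lambda>_ :: unit. v)) (Inr ())"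

lemma fold_mutate_matrix_cong:
  assumes "\<And>k j. Bt (Inl k) j = Bt' (Inl k) j" "\<And>j. Bt (Inr i) j = Bt' (Inr i') j"
  shows "fold mutate_matrix t Bt (Inl k) j = fold mutate_matrix t Bt' (Inl k) j \<and>
    fold mutate_matrix t Bt (Inr i) j = fold mutate_matrix t Bt' (Inr i') j"
  by (induction t arbitrary: k j rule: rev_induct) (simp_all add: assms mutate_matrix_def)

lemma fold_mutate_matrix_Inl_cong:
  assumes "\<And>k j. Bt (Inl k) j = Bt' (Inl k) j"
  shows "fold mutate_matrix t Bt (Inl k) j = fold mutate_matrix t Bt' (Inl k) j"
  by (induction t arbitrary: k j rule: rev_induct) (simp_all add: assms mutate_matrix_def)

lemma fold_mutate_matrix_Inr:
  "fold mutate_matrix t Bt (Inr i) j = mutated_row (\<lambda>k. Bt (Inl k)) t (Bt (Inr i)) j"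
  unfolding mutated_row_def by (rule fold_mutate_matrix_cong[THEN conjunct2]) simp_all

lemma mutated_row_zero: "mutated_row M t (\<lambda>_. 0) j = 0"
  unfolding mutated_row_def
  by (induction t arbitrary: j rule: rev_induct) (simp_all add: mutate_matrix_def)

text \<open>
  The linear relation \<open>v = (\<Sum>i\<in>S. c i * b\<^sub>i)\<close> among the rows \<open>b\<^sub>i\<close>, required to be preserved by all
  mutation maps and, after each of them, by taking negative parts. The first family of equations is
  what compatibility with the coefficients \<open>y\<^sub>j\<close> demands, the second what compatibility with
  \<open>y\<^sub>j \<oplus> 1\<close> demands.
\<close>

definition coherent_combination ::
  "('n, 'i) ext_matrix \<Rightarrow> 'i set \<Rightarrow> ('i \<Rightarrow> real) \<Rightarrow> ('n \<Rightarrow> real) \<Rightarrow> bool" where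
  "coherent_combination Bt S c v \<longleftrightarrow> (\<forall>t\<in>tree_vertices. \<forall>j.
     (\<Sum>i\<in>S. c i * fold mutate_matrix t Bt (Inr i) j) = mutated_row (\<lambda>k. Bt (Inl k)) t v j \<and>
     (\<Sum>i\<in>S. c i * min (fold mutate_matrix t Bt (Inr i) j) 0) =
       min (mutated_row (\<lambda>k. Bt (Inl k)) t v j) 0)"

definition rows_span :: "real set \<Rightarrow> 'i set \<Rightarrow> ('n, 'i) ext_matrix \<Rightarrow> bool" where
  "rows_span R I Bt \<longleftrightarrow> (\<forall>v. (\<forall>j. v j \<in> R) \<longrightarrow>
     (\<exists>S c. finite S \<and> S \<subseteq> I \<and> (\<forall>i\<in>S. c i \<in> R) \<and> coherent_combination Bt S c v))"

text \<open>
  Mutation maps fix \<open>0\<close> (\<open>mutated_row_zero\<close>), so a coherent combination with value \<open>0\<close> imposes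
  homogeneous linear equations on its coefficients, and a difference of two coherent combinations with the same
  value is again a solution.
\<close>

definition rows_independent :: "real set \<Rightarrow> 'i set \<Rightarrow> ('n, 'i) ext_matrix \<Rightarrow> bool" where
  "rows_independent R I Bt \<longleftrightarrow>
     (\<forall>S c. finite S \<and> S \<subseteq> I \<and> (\<forall>i\<in>S. c i \<in> R) \<and> coherent_combination Bt S c (\<lambda>_. 0) \<longrightarrow>
        (\<forall>i\<in>S. c i = 0))"

lemma rows_independentD:
  assumes "rows_independent R I Bt" "coherent_combination Bt S c (\<lambda>_. 0)" "finite S" "S \<subseteq> I"
    "\<And>i. i \<in> S \<Longrightarrow> c i \<in> R"
  shows "\<forall>i\<in>S. c i = 0"
  by (rule assms(1)[unfolded rows_independent_def, THEN spec, THEN spec, THEN mp])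
    (use assms(2-) in simp)

section \<open>Continuous linear maps of tropical semifields\<close>

text \<open>
  Row \<open>i'\<close> of the matrix \<open>p\<close> has its support in \<open>S i'\<close>. Exponents outside \<open>I'\<close> are \<open>0\<close>, the default
  value in \<open>tropical R I'\<close>. The map is additive on all of \<open>'i trop\<close>, with arbitrary real exponents.
\<close>

definition trop_matrix_map ::
  "'j set \<Rightarrow> ('j \<Rightarrow> 'i set) \<Rightarrow> ('j \<Rightarrow> 'i \<Rightarrow> real) \<Rightarrow> 'i trop \<Rightarrow> 'j trop" where
  "trop_matrix_map I' S p a = Trop (\<lambda>i'. if i' \<in> I' then \<Sum>i\<in>S i'. p i' i * texp a i else 0)"

lemma texp_trop_matrix_map:
  "texp (trop_matrix_map I' S p a) i' = (if i' \<in> I' then \<Sum>i\<in>S i'. p i' i * texp a i else 0)"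
  by (simp add: trop_matrix_map_def)

lemma trop_matrix_map_add:
  "trop_matrix_map I' S p (a + b) = trop_matrix_map I' S p a + trop_matrix_map I' S p b"
  by (simp add: trop_eq_iff texp_trop_matrix_map distrib_left sum.distrib)

lemma trop_matrix_map_zero: "trop_matrix_map I' S p 0 = 0"
  by (simp add: trop_eq_iff texp_trop_matrix_map)

lemma trop_matrix_map_scale:
  "trop_matrix_map I' S p (tscale c a) = tscale c (trop_matrix_map I' S p a)"
  by (simp add: trop_eq_iff texp_trop_matrix_map sum_distrib_left mult_ac)

lemma trop_matrix_map_tropical:
  assumes R: "underlying_field R"
    and p: "\<And>i'. i' \<in> I' \<Longrightarrow> S i' \<subseteq> I" "\<And>i' i. i' \<in> I' \<Longrightarrow> i \<in> S i' \<Longrightarrow> p i' i \<in> R"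
    and a: "a \<in> tropical R I"
  shows "trop_matrix_map I' S p a \<in> tropical R I'"
  using a p by (auto simp: tropical_def texp_trop_matrix_map subset_iff
      intro!: underlying_field_sum[OF R] underlying_fieldD(5)[OF R])

lemma topspace_tropical_topology: "topspace (tropical_topology R I) = tropical R I"
  by (auto simp: tropical_topology_def topspace_pullback_topology tropical_def)

text \<open>
  Fixing the finitely many coordinates in \<open>S\<close> is an open condition in a product of discrete
  spaces, and \<open>F\<close> is constant on the neighbourhood that it defines.
\<close>

lemma continuous_map_finite_dependence:
  assumes "finite S" "S \<subseteq> I"
    and F: "\<And>f. f \<in> (\<Pi>\<^sub>E i\<in>I. R) \<Longrightarrow> F f \<in> R'"
    and dep: "\<And>f f'. (\<And>i. i \<in> S \<Longrightarrow> f i = f' i) \<Longrightarrow> F f = F f'"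
  shows "continuous_map (product_topology (\<lambda>_. discrete_topology R) I) (discrete_topology R') F"
proof -
  let ?P = "product_topology (\<lambda>_. discrete_topology R) I"
  have "openin ?P {f \<in> topspace ?P. F f \<in> U}" for U
  proof (subst openin_subopen, intro ballI)
    fix f assume f: "f \<in> {f \<in> topspace ?P. F f \<in> U}"
    let ?N = "\<Pi>\<^sub>E i\<in>I. if i \<in> S then {f i} else R"
    have fR: "f i \<in> R" if "i \<in> I" for i
      using f that by (auto simp: PiE_iff)
    have "finite {i \<in> I. (if i \<in> S then {f i} else R) \<noteq> R}"
      by (rule finite_subset[OF _ assms(1)]) auto
    then have "openin ?P ?N"
      using fR by (auto simp: openin_PiE_gen)
    moreover have "f \<in> ?N"
      using f by (auto simp: PiE_iff)
    moreover have "?N \<subseteq> {f \<in> topspace ?P. F f \<in> U}"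
    proof
      fix f' assume f': "f' \<in> ?N"
      have "f' i = f i" if "i \<in> S" for i
        using f' that assms(2) by (force simp: PiE_iff)
      then have "F f' = F f" by (rule dep)
      moreover have "f' i \<in> R" if "i \<in> I" for i
        using f' that fR[OF that] by (auto simp: PiE_iff split: if_splits dest!: bspec)
      then have "f' \<in> topspace ?P"
        using f' by (auto simp: PiE_iff)
      ultimately show "f' \<in> {f \<in> topspace ?P. F f \<in> U}"
        using f by simp
    qed
    ultimately show "\<exists>T. openin ?P T \<and> f \<in> T \<and> T \<subseteq> {f \<in> topspace ?P. F f \<in> U}"
      by blast
  qed
  then show ?thesis
    using F by (auto simp: continuous_map_def)
qed

lemma continuous_map_trop_matrix_map:
  assumes R: "underlying_field R"
    and p: "\<And>i'. i' \<in> I' \<Longrightarrow> finite (S i')" "\<And>i'. i' \<in> I' \<Longrightarrow> S i' \<subseteq> I"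
      "\<And>i' i. i' \<in> I' \<Longrightarrow> i \<in> S i' \<Longrightarrow> p i' i \<in> R"
  shows "continuous_map (tropical_topology R I) (tropical_topology R I') (trop_matrix_map I' S p)"
proof -
  let ?P = "product_topology (\<lambda>_. discrete_topology R) I"
  let ?G = "\<lambda>f. restrict (\<lambda>i'. \<Sum>i\<in>S i'. p i' i * f i) I'"
  have comp: "continuous_map ?P (discrete_topology R) (\<lambda>f. \<Sum>i\<in>S i'. p i' i * f i)"
    if i': "i' \<in> I'" for i'
    by (rule continuous_map_finite_dependence[OF p(1,2)[OF i']])
      (use p(2,3)[OF i'] in \<open>auto simp: PiE_iff subset_iff
        intro!: underlying_field_sum[OF R] underlying_fieldD(5)[OF R]\<close>)
  have "continuous_map ?P (product_topology (\<lambda>_. discrete_topology R) I') ?G"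
    using comp by (auto simp: continuous_map_componentwise)
  then have "continuous_map (tropical_topology R I) (product_topology (\<lambda>_. discrete_topology R) I')
      (?G \<circ> (\<lambda>a. restrict (texp a) I))"
    unfolding tropical_topology_def by (rule continuous_map_pullback)
  moreover have "?G \<circ> (\<lambda>a. restrict (texp a) I) =
      (\<lambda>a. restrict (texp a) I') \<circ> trop_matrix_map I' S p"
  proof (intro ext)
    fix a i'
    have "(\<Sum>i\<in>S i'. p i' i * restrict (texp a) I i) = (\<Sum>i\<in>S i'. p i' i * texp a i)" if "i' \<in> I'"
      using p(2)[OF that] by (intro sum.cong) auto
    then show "(?G \<circ> (\<lambda>a. restrict (texp a) I)) a i' =
        ((\<lambda>a. restrict (texp a) I') \<circ> trop_matrix_map I' S p) a i'"
      by (simp add: texp_trop_matrix_map)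
  qed
  ultimately have *: "continuous_map (tropical_topology R I) (product_topology (\<lambda>_. discrete_topology R) I')
      ((\<lambda>a. restrict (texp a) I') \<circ> trop_matrix_map I' S p)"
    by simp
  have "topspace (tropical_topology R I) \<subseteq> trop_matrix_map I' S p -` tropical R I'"
    using trop_matrix_map_tropical[OF R p(2,3)] by (auto simp: topspace_tropical_topology)
  with * show ?thesis
    unfolding tropical_topology_def[of R I'] by (rule continuous_map_pullback')
qed

definition trop_unit :: "'i \<Rightarrow> 'i trop" where
  "trop_unit i = Trop (\<lambda>j. if j = i then 1 else 0)"

lemma trop_unit_tropical: "underlying_field R \<Longrightarrow> i \<in> I \<Longrightarrow> trop_unit i \<in> tropical R I"
  by (auto simp: trop_unit_def tropical_def underlying_fieldD)

text \<open>
  The elements whose image has exponent \<open>0\<close> at \<open>i'\<close> form an open set containing the unit. A basic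
  neighbourhood of the unit restricts only finitely many coordinates, those in \<open>S\<close>. So exponents
  outside \<open>S\<close> do not contribute, and linearity determines the contribution of the others by the
  images of the generators \<open>u\<^sub>i\<close>. The formula is stated for all finite \<open>T \<supseteq> S\<close> so that the
  expansions of two maps can be compared over a common index set.
\<close>

lemma continuous_linear_finite_expansion:
  assumes R: "underlying_field R"
    and mem: "\<And>a. a \<in> tropical R I \<Longrightarrow> \<psi> a \<in> tropical R I'"
    and add: "\<And>a b. a \<in> tropical R I \<Longrightarrow> b \<in> tropical R I \<Longrightarrow> \<psi> (a + b) = \<psi> a + \<psi> b"
    and scale: "\<And>c a. c \<in> R \<Longrightarrow> a \<in> tropical R I \<Longrightarrow> \<psi> (tscale c a) = tscale c (\<psi> a)"
    and cont: "continuous_map (tropical_topology R I) (tropical_topology R I') \<psi>"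
    and i': "i' \<in> I'"
  obtains S where "finite S" "S \<subseteq> I"
    "\<And>T a. finite T \<Longrightarrow> S \<subseteq> T \<Longrightarrow> T \<subseteq> I \<Longrightarrow> a \<in> tropical R I \<Longrightarrow>
      texp (\<psi> a) i' = (\<Sum>i\<in>T. texp (\<psi> (trop_unit i)) i' * texp a i)"
proof -
  let ?P = "\<lambda>I. product_topology (\<lambda>_. discrete_topology R) I"
  note z = tropical_zero[OF R, of I]
  have psi0: "\<psi> 0 = 0"
    using add[OF z z] by simp
  have "openin (?P I') (\<Pi>\<^sub>E j\<in>I'. if j = i' then {0} else R)"
  proof -
    have "finite {j \<in> I'. (if j = i' then {0} else R) \<noteq> R}"
      by (rule finite_subset[of _ "{i'}"]) auto
    then show ?thesis
      using underlying_fieldD(1)[OF R] by (auto simp: openin_PiE_gen)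
  qed
  then have "openin (tropical_topology R I')
      ((\<lambda>a. restrict (texp a) I') -` (\<Pi>\<^sub>E j\<in>I'. if j = i' then {0} else R) \<inter> tropical R I')"
    unfolding tropical_topology_def openin_pullback_topology by blast
  then have "openin (tropical_topology R I) {a \<in> tropical R I. \<psi> a \<in>
      ((\<lambda>a. restrict (texp a) I') -` (\<Pi>\<^sub>E j\<in>I'. if j = i' then {0} else R) \<inter> tropical R I')}"
    using openin_continuous_map_preimage[OF cont] by (simp only: topspace_tropical_topology)
  then obtain U where U: "openin (?P I) U"
    "{a \<in> tropical R I. \<psi> a \<in>
      ((\<lambda>a. restrict (texp a) I') -` (\<Pi>\<^sub>E j\<in>I'. if j = i' then {0} else R) \<inter> tropical R I')} =
      (\<lambda>a. restrict (texp a) I) -` U \<inter> tropical R I"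
    unfolding tropical_topology_def openin_pullback_topology by blast
  have "0 \<in> (\<lambda>a. restrict (texp a) I) -` U \<inter> tropical R I"
    unfolding U(2)[symmetric] using z tropical_zero[OF R, of I'] underlying_fieldD(1)[OF R]
    by (auto simp: psi0)
  then have "restrict (texp 0) I \<in> U" by simp
  from product_topology_open_contains_basis[OF U(1) this]
  obtain X where X: "restrict (texp 0) I \<in> (\<Pi>\<^sub>E i\<in>I. X i)" "finite {i. X i \<noteq> R}"
    "(\<Pi>\<^sub>E i\<in>I. X i) \<subseteq> U"
    by auto
  let ?S = "{i \<in> I. X i \<noteq> R}"
  have kernel: "texp (\<psi> a) i' = 0" if a: "a \<in> tropical R I" "\<And>i. i \<in> ?S \<Longrightarrow> texp a i = 0" for a
  proof -
    have "texp a i \<in> X i" if i: "i \<in> I" for i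
    proof (cases "i \<in> ?S")
      case True
      then show ?thesis using X(1) a(2)[of i] i by (auto simp: PiE_iff)
    next
      case False
      then show ?thesis using a(1) i by (auto simp: tropical_def)
    qed
    then have "restrict (texp a) I \<in> U"
      using X(3) by (auto simp: subset_iff)
    then have "a \<in> (\<lambda>a. restrict (texp a) I) -` U \<inter> tropical R I"
      using a(1) by simp
    then show ?thesis
      unfolding U(2)[symmetric] using i' by (auto simp: PiE_iff dest!: bspec[of _ _ i'])
  qed
  show ?thesis
  proof (rule that[of ?S])
    show "finite ?S" by (rule finite_subset[OF _ X(2)]) auto
    show "?S \<subseteq> I" by auto
    fix T a assume T: "finite T" "?S \<subseteq> T" "T \<subseteq> I" and a: "a \<in> tropical R I"
    have aR: "texp a i \<in> R" if "i \<in> I" for i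
      using a that by (auto simp: tropical_def)
    \<comment> \<open>The element \<open>a\<close> is the product of its part over \<open>T\<close>, which is a finite product of powers of
      generators, and its part outside \<open>T\<close>, which is in the kernel.\<close>
    define part where "part T' = Trop (\<lambda>i. if i \<in> T' then texp a i else 0)" for T'
    have part_mem: "part T' \<in> tropical R I" if "T' \<subseteq> I" for T'
      using that aR by (auto simp: part_def tropical_def underlying_fieldD(1)[OF R])
    have "texp (\<psi> (part T')) i' = (\<Sum>i\<in>T'. texp (\<psi> (trop_unit i)) i' * texp a i)"
      if "finite T'" "T' \<subseteq> I" for T'
      using that
    proof (induction T' rule: finite_induct)
      case empty
      have "part {} = 0" by (simp add: part_def trop_eq_iff)
      then show ?case by (simp add: psi0)
    next
      case (insert k T')
      have "part (insert k T') = tscale (texp a k) (trop_unit k) + part T'"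
        using insert.hyps(2) by (auto simp: part_def trop_unit_def trop_eq_iff)
      moreover have "tscale (texp a k) (trop_unit k) \<in> tropical R I"
        using insert.prems aR underlying_fieldD(1)[OF R]
        by (auto simp: tropical_def trop_unit_def)
      ultimately show ?case
        using insert part_mem[of T'] trop_unit_tropical[OF R, of k I] aR[of k]
        by (simp add: add scale)
    qed
    then have T_sum: "texp (\<psi> (part T)) i' = (\<Sum>i\<in>T. texp (\<psi> (trop_unit i)) i' * texp a i)"
      using T by blast
    have "texp a i = 0" if "i \<notin> I" for i
      using a that by (auto simp: tropical_def)
    then have split: "a = part T + part (I - T)"
      using T(3) by (auto simp: part_def trop_eq_iff)
    have "texp (\<psi> (part (I - T))) i' = 0"
      using T(2) by (intro kernel part_mem) (auto simp: part_def)
    then show "texp (\<psi> a) i' = (\<Sum>i\<in>T. texp (\<psi> (trop_unit i)) i' * texp a i)"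
      using T(3) by (subst split) (simp add: add part_mem T_sum)
  qed
qed

section \<open>Coefficient specializations\<close>

text \<open>
  This is where coherence is used in full: its two families of equations are the two conclusions,
  read exponent by exponent.
\<close>

lemma trop_matrix_map_coeff_at:
  assumes p: "\<And>i'. i' \<in> I' \<Longrightarrow> S i' \<subseteq> I"
    "\<And>i'. i' \<in> I' \<Longrightarrow> coherent_combination (snd s) (S i') (p i') (snd s' (Inr i'))"
    and B: "\<And>i j. snd s (Inl i) j = snd s' (Inl i) j" and t: "t \<in> tree_vertices"
  shows "trop_matrix_map I' S p (coeff_at I s j t) = coeff_at I' s' j t"
    and "trop_matrix_map I' S p (tplus (coeff_at I s j t) 0) = tplus (coeff_at I' s' j t) 0"
proof -
  have B': "(\<lambda>k. snd s (Inl k)) = (\<lambda>k. snd s' (Inl k))"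
    using B by (simp add: fun_eq_iff)
  have "texp (trop_matrix_map I' S p (coeff_at I s j t)) i' = texp (coeff_at I' s' j t) i' \<and>
    texp (trop_matrix_map I' S p (tplus (coeff_at I s j t) 0)) i' =
      texp (tplus (coeff_at I' s' j t) 0) i'" for i'
  proof (cases "i' \<in> I'")
    case True
    let ?r = "\<lambda>i. fold mutate_matrix t (snd s) (Inr i) j"
    have "texp (coeff_at I s j t) i = ?r i" if "i \<in> S i'" for i
      using p(1)[OF True] that by (auto simp: coeff_at_eq coefficient_def)
    then have "(\<Sum>i\<in>S i'. p i' i * texp (coeff_at I s j t) i) = (\<Sum>i\<in>S i'. p i' i * ?r i)"
      "(\<Sum>i\<in>S i'. p i' i * min (texp (coeff_at I s j t) i) 0) = (\<Sum>i\<in>S i'. p i' i * min (?r i) 0)"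
      by simp_all
    then show ?thesis
      using p(2)[OF True] True t
      by (simp add: texp_trop_matrix_map coherent_combination_def coeff_at_eq coefficient_def
          fold_mutate_matrix_Inr[of t "snd s'"] B')
  next
    case False
    then show ?thesis
      by (simp add: texp_trop_matrix_map coeff_at_eq coefficient_def)
  qed
  then show "trop_matrix_map I' S p (coeff_at I s j t) = coeff_at I' s' j t"
    "trop_matrix_map I' S p (tplus (coeff_at I s j t) 0) = tplus (coeff_at I' s' j t) 0"
    by (simp_all add: trop_eq_iff)
qed

text \<open>
  The homomorphism is read off from the graph of the specialization of rational functions that maps
  coefficients by the matrix \<open>p\<close> and the initial cluster to the initial cluster. The subring on
  which it is defined contains the cluster algebra because the cluster variables of the target do
  not vanish.
\<close>

lemma coeff_specialization_exists:
  fixes s :: "('n::{finite,linorder}, 'i) seed" and s' :: "('n, 'j) seed"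
  assumes R: "underlying_field R" and s: "is_seed R I s" and s': "is_seed R I' s'"
    and B: "\<And>i j. snd s (Inl i) j = snd s' (Inl i) j"
    and p: "\<And>i'. i' \<in> I' \<Longrightarrow> finite (S i')" "\<And>i'. i' \<in> I' \<Longrightarrow> S i' \<subseteq> I"
      "\<And>i' i. i' \<in> I' \<Longrightarrow> i \<in> S i' \<Longrightarrow> p i' i \<in> R"
      "\<And>i'. i' \<in> I' \<Longrightarrow> coherent_combination (snd s) (S i') (p i') (snd s' (Inr i'))"
  obtains \<phi> where "\<phi> \<in> extensional (cluster_algebra R I s)" "coeff_specialization R I s I' s' \<phi>"
    "\<And>a. a \<in> tropical R I \<Longrightarrow> \<phi> (trop_elem a) = trop_elem (trop_matrix_map I' S p a)"
proof -
  let ?A = "cluster_algebra R I s" and ?A' = "cluster_algebra R I' s'"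
  define \<psi> where "\<psi> = trop_matrix_map I' S p"
  have is_hom: "is_ring_hom (\<lambda>r. const_ratfun (Poly_Mapping.single (0 :: 'j trop) r))"
    unfolding is_ring_hom_def
    by (simp add: single_add const_ratfun_simps flip: mult_single[of 0 _ 0, simplified])
  interpret ratfun_specialization R I "fst s"
    "\<lambda>r. const_ratfun (Poly_Mapping.single (0 :: 'j trop) r) :: ('n, 'j) ratfun"
    "\<lambda>a. trop_elem (\<psi> a)" "fst s'"
    using s is_hom by unfold_locales
      (auto simp: R is_seed_def \<psi>_def trop_matrix_map_zero trop_matrix_map_add trop_elem_zero trop_elem_add)
  have ext: "ext_exchange_matrix R I (snd s)" "ext_exchange_matrix R I' (snd s')"
    using s s' by (simp_all add: is_seed_def)
  have psi_mem: "\<psi> a \<in> tropical R I'" if "a \<in> tropical R I" for a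
    unfolding \<psi>_def by (rule trop_matrix_map_tropical[OF R p(2,3) that])
  have psi_coeff: "\<psi> (coeff_at I s j t) = coeff_at I' s' j t"
    "\<psi> (tplus (coeff_at I s j t) 0) = tplus (coeff_at I' s' j t) 0"
    if "t \<in> tree_vertices" for j t
    unfolding \<psi>_def by (rule trop_matrix_map_coeff_at[OF p(2,4) B that], assumption+)+
  have cluster: "(cluster_var I s j t, cluster_var I' s' j t) \<in> graph"
    if "t \<in> tree_vertices" for j t
    using that
  proof (induction arbitrary: j rule: tree_vertices_induct)
    case Nil
    show ?case by (simp add: cluster_var_Nil graph_var)
  next
    case (snoc t k)
    have "coeff_at I s k t \<in> tropical R I"
      by (rule coeff_at_tropical[OF R ext(1)])
    then show ?case
      using graph_exchange[of "\<lambda>j. cluster_var I s j t" "\<lambda>j. cluster_var I' s' j t" k "coeff_at I s k t"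
          "\<lambda>i. nat \<lfloor>fold mutate_matrix t (snd s') (Inl i) k\<rfloor>"
          "\<lambda>i. nat \<lfloor>- fold mutate_matrix t (snd s') (Inl i) k\<rfloor>", OF snoc.IH cluster_var_nonzero[OF R s']] snoc
      by (simp add: cluster_var_snoc psi_coeff fold_mutate_matrix_Inl_cong[of "snd s" "snd s'", OF B])
  qed
  have total: "\<exists>b\<in>?A'. (a, b) \<in> graph" if "a \<in> ?A" for a
  proof -
    let ?S = "{a. \<exists>b\<in>?A'. (a, b) \<in> graph}"
    note A' = is_subring_cluster_algebra[of R I' s']
    have "is_subring ?S"
      unfolding is_subring_def
    proof (intro conjI ballI)
      show "1 \<in> ?S"
        using graph_one is_subringD(1)[OF A'] by blast
    next
      fix a c assume "a \<in> ?S" "c \<in> ?S"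
      then obtain b d where "b \<in> ?A'" "(a, b) \<in> graph" "d \<in> ?A'" "(c, d) \<in> graph"
        by blast
      then show "a - c \<in> ?S" "a * c \<in> ?S"
        using graph_diff[of a b c d] graph_mult[of a b c d] is_subringD(2,3)[OF A', of b d] by auto
    qed
    moreover have "trop_elem a \<in> ?S" if "a \<in> tropical R I" for a
      using graph_trop_elem[OF that] trop_elem_mem_cluster_algebra[OF psi_mem[OF that]] by blast
    moreover have "cluster_var I s j t \<in> ?S" if "t \<in> tree_vertices" for j t
      using cluster[OF that] cluster_var_mem_cluster_algebra[OF that] by blast
    ultimately have "?A \<subseteq> ?S"
      by (rule cluster_algebra_subset)
    then show ?thesis using that by blast
  qed
  define \<phi> where "\<phi> = restrict (\<lambda>a. THE b. (a, b) \<in> graph) ?A"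
  have phi_eq: "\<phi> a = b" if "a \<in> ?A" "(a, b) \<in> graph" for a b
    using that graph_unique by (auto simp: \<phi>_def intro!: the_equality)
  have phi: "(a, \<phi> a) \<in> graph" "\<phi> a \<in> ?A'" if "a \<in> ?A" for a
    using total[OF that] phi_eq[OF that] by auto
  note A = is_subringD[OF is_subring_cluster_algebra[of R I s]]
  have phi_trop: "\<phi> (trop_elem a) = trop_elem (\<psi> a)" if "a \<in> tropical R I" for a
    by (intro phi_eq trop_elem_mem_cluster_algebra graph_trop_elem that)
  have hom: "ring_hom_on ?A ?A' \<phi>"
    unfolding ring_hom_on_def
  proof (intro conjI ballI)
    show "\<phi> ` ?A \<subseteq> ?A'" "\<phi> 1 = 1"
      using phi(2) phi_eq[OF A(1) graph_one] by auto
    show "\<phi> (a + b) = \<phi> a + \<phi> b" "\<phi> (a * b) = \<phi> a * \<phi> b" if "a \<in> ?A" "b \<in> ?A" for a b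
      using that by (auto intro!: phi_eq A graph_add graph_mult phi(1))
  qed
  have cont: "continuous_map (tropical_topology R I) (tropical_topology R I') \<psi>"
    unfolding \<psi>_def by (rule continuous_map_trop_matrix_map[OF R p(1,2,3)])
  have "\<phi> (fst s j) = fst s' j" for j
    using phi_eq[OF cluster_var_mem_cluster_algebra cluster, OF tree_vertices_Nil tree_vertices_Nil]
    by (simp add: cluster_var_Nil)
  moreover have "\<exists>\<psi>. (\<forall>a\<in>tropical R I. \<psi> a \<in> tropical R I' \<and> \<phi> (trop_elem a) = trop_elem (\<psi> a)) \<and>
      (\<forall>a\<in>tropical R I. \<forall>b\<in>tropical R I. \<psi> (a + b) = \<psi> a + \<psi> b) \<and>
      (\<forall>c\<in>R. \<forall>a\<in>tropical R I. \<psi> (tscale c a) = tscale c (\<psi> a)) \<and>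
      continuous_map (tropical_topology R I) (tropical_topology R I') \<psi>"
    using psi_mem phi_trop cont
    by (intro exI[of _ \<psi>]) (simp add: \<psi>_def trop_matrix_map_add trop_matrix_map_scale)
  moreover have "\<phi> (trop_elem (coeff_at I s j t)) = trop_elem (coeff_at I' s' j t) \<and>
      \<phi> (trop_elem (tplus (coeff_at I s j t) 0)) = trop_elem (tplus (coeff_at I' s' j t) 0)"
    if "t \<in> tree_vertices" for j t
    using that by (simp add: phi_trop psi_coeff coeff_at_tropical[OF R ext(1)]
        tropical_tplus tropical_zero[OF R])
  ultimately have "coeff_specialization R I s I' s' \<phi>"
    unfolding coeff_specialization_def using hom B by blast
  then show ?thesis
    using that[of \<phi>] phi_trop by (simp add: \<phi>_def \<psi>_def)
qed

text \<open>
  Applying \<open>\<phi>\<close> to an exchange relation, with denominators cleared so that it holds inside the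
  cluster algebra, gives the exchange relation of the target. It can be solved for the new cluster
  variable because the old one does not vanish there.
\<close>

lemma coeff_specialization_cluster_var:
  fixes s :: "('n::{finite,linorder}, 'i) seed" and s' :: "('n, 'j) seed"
  assumes R: "underlying_field R" and s: "is_seed R I s" and s': "is_seed R I' s'"
    and \<phi>: "coeff_specialization R I s I' s' \<phi>" and t: "t \<in> tree_vertices"
  shows "\<phi> (cluster_var I s j t) = cluster_var I' s' j t"
  using t
proof (induction arbitrary: j rule: tree_vertices_induct)
  case Nil
  show ?case
    using \<phi> by (simp add: cluster_var_Nil coeff_specialization_def)
next
  case (snoc t k)
  let ?A = "cluster_algebra R I s" and ?M = "fold mutate_matrix t (snd s)"
  let ?y = "coeff_at I s k t" and ?y' = "coeff_at I' s' k t"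
  let ?N = "\<lambda>x :: 'n \<Rightarrow> _. \<lambda>y. y * (\<Prod>i\<in>UNIV. x i ^ nat \<lfloor>?M (Inl i) k\<rfloor>)
      + (\<Prod>i\<in>UNIV. x i ^ nat \<lfloor>- ?M (Inl i) k\<rfloor>)"
  note subring = is_subring_cluster_algebra[of R I s]
  note A = is_subringD[OF subring]
  have hom: "\<phi> 1 = 1" "\<And>a b. a \<in> ?A \<Longrightarrow> b \<in> ?A \<Longrightarrow> \<phi> (a + b) = \<phi> a + \<phi> b"
    "\<And>a b. a \<in> ?A \<Longrightarrow> b \<in> ?A \<Longrightarrow> \<phi> (a * b) = \<phi> a * \<phi> b"
    using \<phi> by (auto simp: coeff_specialization_def ring_hom_on_def)
  have power: "\<phi> (a ^ e) = \<phi> a ^ e" if "a \<in> ?A" for a e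
    using that by (induction e) (simp_all add: hom A)
  have prod: "\<phi> (prod f S) = (\<Prod>i\<in>S. \<phi> (f i))" if "\<And>i. f i \<in> ?A" for f :: "'n \<Rightarrow> _" and S
    using that by (induction S rule: infinite_finite_induct) (simp_all add: hom is_subring_prod[OF subring])
  have B: "snd s (Inl i) j = snd s' (Inl i) j" for i j
    using \<phi> by (simp add: coeff_specialization_def)
  have y: "\<phi> (trop_elem ?y) = trop_elem ?y'"
    "\<phi> (trop_elem (tplus ?y 0)) = trop_elem (tplus ?y' 0)"
    using \<phi> snoc.hyps(1) by (auto simp: coeff_specialization_def)
  have "?y \<in> tropical R I"
    using s by (intro coeff_at_tropical[OF R]) (simp add: is_seed_def)
  then have mem: "trop_elem ?y \<in> ?A" "trop_elem (tplus ?y 0) \<in> ?A"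
    "cluster_var I s i t \<in> ?A" "cluster_var I s i (t @ [k]) \<in> ?A" for i
    using snoc.hyps by (auto intro!: trop_elem_mem_cluster_algebra cluster_var_mem_cluster_algebra
        tropical_tplus tropical_zero[OF R])
  have "cluster_var I s k (t @ [k]) * (cluster_var I s k t * trop_elem (tplus ?y 0)) =
      ?N (\<lambda>i. cluster_var I s i t) (trop_elem ?y)"
    using cluster_var_nonzero[OF R s, of k t] by (simp add: cluster_var_snoc trop_elem_nonzero)
  then have "\<phi> (cluster_var I s k (t @ [k]) * (cluster_var I s k t * trop_elem (tplus ?y 0))) =
      \<phi> (?N (\<lambda>i. cluster_var I s i t) (trop_elem ?y))"
    by simp
  then have "\<phi> (cluster_var I s k (t @ [k])) * (cluster_var I' s' k t * trop_elem (tplus ?y' 0)) =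
      ?N (\<lambda>i. cluster_var I' s' i t) (trop_elem ?y')"
    by (simp add: hom mem A prod power is_subring_prod[OF subring] y snoc.IH)
  then have "\<phi> (cluster_var I s k (t @ [k])) = cluster_var I' s' k (t @ [k])"
    using cluster_var_nonzero[OF R s', of k t]
    by (simp add: cluster_var_snoc trop_elem_nonzero fold_mutate_matrix_Inl_cong[of "snd s" "snd s'", OF B] eq_divide_eq)
  then show ?case
    using snoc.IH by (cases "j = k") (simp_all add: cluster_var_snoc)
qed

text \<open>
  The equalizer of two specializations is a subring, and the values on cluster variables are forced.
\<close>

lemma coeff_specialization_eqI:
  fixes s :: "('n::{finite,linorder}, 'i) seed" and s' :: "('n, 'j) seed"
  assumes R: "underlying_field R" and s: "is_seed R I s" and s': "is_seed R I' s'"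
    and \<phi>: "coeff_specialization R I s I' s' \<phi>" "coeff_specialization R I s I' s' \<phi>'"
    and ext: "\<phi> \<in> extensional (cluster_algebra R I s)" "\<phi>' \<in> extensional (cluster_algebra R I s)"
    and trop: "\<And>a. a \<in> tropical R I \<Longrightarrow> \<phi> (trop_elem a) = \<phi>' (trop_elem a)"
  shows "\<phi> = \<phi>'"
proof -
  let ?A = "cluster_algebra R I s"
  let ?E = "{a \<in> ?A. \<phi> a = \<phi>' a}"
  note A = is_subringD[OF is_subring_cluster_algebra[of R I s]]
  have diff: "\<theta> (a - b) = \<theta> a - \<theta> b" if "ring_hom_on ?A (cluster_algebra R I' s') \<theta>" "a \<in> ?A" "b \<in> ?A"
    for \<theta> :: "('n, 'i) ratfun \<Rightarrow> ('n, 'j) ratfun" and a b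
  proof -
    have "\<theta> ((a - b) + b) = \<theta> (a - b) + \<theta> b"
      using that A(2) unfolding ring_hom_on_def by blast
    then show ?thesis by simp
  qed
  have hom: "ring_hom_on ?A (cluster_algebra R I' s') \<phi>" "ring_hom_on ?A (cluster_algebra R I' s') \<phi>'"
    using \<phi> by (auto simp: coeff_specialization_def)
  have "is_subring ?E"
    using hom by (auto simp: is_subring_def A diff[OF hom(1)] diff[OF hom(2)] ring_hom_on_def)
  then have "?A \<subseteq> ?E"
    by (rule cluster_algebra_subset)
      (auto simp: trop trop_elem_mem_cluster_algebra cluster_var_mem_cluster_algebra
        coeff_specialization_cluster_var[OF R s s' \<phi>(1)] coeff_specialization_cluster_var[OF R s s' \<phi>(2)])
  then show ?thesis
    using ext by (intro extensionalityI[of _ ?A]) auto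
qed

text \<open>
  The exponents at \<open>i'\<close> of the images of the generators \<open>u\<^sub>i\<close> form a row with entries in \<open>R\<close> that
  determines the exponent at \<open>i'\<close> of every image, and that expresses \<open>v\<close> as a coherent combination
  of coefficient rows. Both hold over each finite set of indices that contains \<open>S\<close>; the entries
  outside \<open>S\<close> contribute nothing.
\<close>

definition coherent_coordinate ::
  "real set \<Rightarrow> 'i set \<Rightarrow> ('n, 'i) ext_matrix \<Rightarrow> ('i trop \<Rightarrow> 'j trop) \<Rightarrow> 'j \<Rightarrow> ('n \<Rightarrow> real) \<Rightarrow> bool" where
  "coherent_coordinate R I Bt \<psi> i' v \<longleftrightarrow>
     (\<forall>i\<in>I. texp (\<psi> (trop_unit i)) i' \<in> R) \<and>
     (\<exists>S. finite S \<and> S \<subseteq> I \<and> (\<forall>T. finite T \<longrightarrow> S \<subseteq> T \<longrightarrow> T \<subseteq> I \<longrightarrow>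
        (\<forall>a\<in>tropical R I. texp (\<psi> a) i' = (\<Sum>i\<in>T. texp (\<psi> (trop_unit i)) i' * texp a i)) \<and>
        coherent_combination Bt T (\<lambda>i. texp (\<psi> (trop_unit i)) i') v))"

text \<open>
  The converse of \<open>coeff_specialization_exists\<close>: expanding the images of the coefficients
  \<open>y\<^sub>j\<close> and of \<open>y\<^sub>j \<oplus> 1\<close> at each vertex by finite sums yields the two families of equations in the
  definition of a coherent combination.
\<close>

lemma coeff_specialization_coherent:
  fixes s :: "('n::{finite,linorder}, 'i) seed" and s' :: "('n, 'j) seed"
  assumes R: "underlying_field R" and s: "is_seed R I s"
    and \<phi>: "coeff_specialization R I s I' s' \<phi>"
  obtains \<psi> where "\<forall>a\<in>tropical R I. \<psi> a \<in> tropical R I' \<and> \<phi> (trop_elem a) = trop_elem (\<psi> a)"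
    "\<forall>i'\<in>I'. coherent_coordinate R I (snd s) \<psi> i' (snd s' (Inr i'))"
proof -
  have ext: "ext_exchange_matrix R I (snd s)"
    using s by (simp add: is_seed_def)
  obtain \<psi> where \<psi>: "\<And>a. a \<in> tropical R I \<Longrightarrow> \<psi> a \<in> tropical R I'"
    "\<And>a. a \<in> tropical R I \<Longrightarrow> \<phi> (trop_elem a) = trop_elem (\<psi> a)"
    "\<And>a b. a \<in> tropical R I \<Longrightarrow> b \<in> tropical R I \<Longrightarrow> \<psi> (a + b) = \<psi> a + \<psi> b"
    "\<And>c a. c \<in> R \<Longrightarrow> a \<in> tropical R I \<Longrightarrow> \<psi> (tscale c a) = tscale c (\<psi> a)"
    "continuous_map (tropical_topology R I) (tropical_topology R I') \<psi>"
    using \<phi> unfolding coeff_specialization_def by blast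
  have B: "(\<lambda>k. snd s (Inl k)) = (\<lambda>k. snd s' (Inl k))"
    using \<phi> by (simp add: coeff_specialization_def fun_eq_iff)
  have mem: "coeff_at I s j t \<in> tropical R I" "tplus (coeff_at I s j t) 0 \<in> tropical R I" for j t
    by (intro tropical_tplus tropical_zero coeff_at_tropical R ext)+
  have coeff: "\<psi> (coeff_at I s j t) = coeff_at I' s' j t"
    "\<psi> (tplus (coeff_at I s j t) 0) = tplus (coeff_at I' s' j t) 0" if "t \<in> tree_vertices" for j t
    using \<phi> that mem \<psi>(2) by (simp_all add: coeff_specialization_def trop_elem_inj)
  have "coherent_coordinate R I (snd s) \<psi> i' (snd s' (Inr i'))" if i': "i' \<in> I'" for i'
  proof -
    have psi_unit: "\<forall>i\<in>I. texp (\<psi> (trop_unit i)) i' \<in> R"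
      using \<psi>(1)[OF trop_unit_tropical[OF R]] i' by (auto simp: tropical_def)
    obtain S where S: "finite S" "S \<subseteq> I"
      "\<And>T a. finite T \<Longrightarrow> S \<subseteq> T \<Longrightarrow> T \<subseteq> I \<Longrightarrow> a \<in> tropical R I \<Longrightarrow>
        texp (\<psi> a) i' = (\<Sum>i\<in>T. texp (\<psi> (trop_unit i)) i' * texp a i)"
      using continuous_linear_finite_expansion[OF R \<psi>(1,3,4,5) i'] by blast
    have "coherent_combination (snd s) T (\<lambda>i. texp (\<psi> (trop_unit i)) i') (snd s' (Inr i'))"
      if T: "finite T" "S \<subseteq> T" "T \<subseteq> I" for T
      unfolding coherent_combination_def
    proof (intro ballI allI)
      fix t :: "'n list" and j assume t: "t \<in> tree_vertices"
      let ?c = "\<lambda>i. texp (\<psi> (trop_unit i)) i'" and ?r = "\<lambda>i. fold mutate_matrix t (snd s) (Inr i) j"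
      have "texp (coeff_at I s j t) i = ?r i" if "i \<in> T" for i
        using T(3) that by (auto simp: coeff_at_eq coefficient_def)
      then have "texp (\<psi> (coeff_at I s j t)) i' = (\<Sum>i\<in>T. ?c i * ?r i)"
        "texp (\<psi> (tplus (coeff_at I s j t) 0)) i' = (\<Sum>i\<in>T. ?c i * min (?r i) 0)"
        using S(3)[OF T mem(1), of j t] S(3)[OF T mem(2), of j t] by simp_all
      moreover have "texp (coeff_at I' s' j t) i' = mutated_row (\<lambda>k. snd s (Inl k)) t (snd s' (Inr i')) j"
        using i' by (simp add: coeff_at_eq coefficient_def fold_mutate_matrix_Inr B)
      ultimately show "(\<Sum>i\<in>T. ?c i * ?r i) = mutated_row (\<lambda>k. snd s (Inl k)) t (snd s' (Inr i')) j \<and>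
          (\<Sum>i\<in>T. ?c i * min (?r i) 0) = min (mutated_row (\<lambda>k. snd s (Inl k)) t (snd s' (Inr i')) j) 0"
        by (simp add: coeff[OF t])
    qed
    note coherent = this
    show ?thesis
      unfolding coherent_coordinate_def
    proof (intro conjI exI[of _ S] allI impI psi_unit S(1,2))
      fix T assume T: "finite T" "S \<subseteq> T" "T \<subseteq> I"
      show "\<forall>a\<in>tropical R I. texp (\<psi> a) i' = (\<Sum>i\<in>T. texp (\<psi> (trop_unit i)) i' * texp a i)"
        by (intro ballI S(3) T)
      show "coherent_combination (snd s) T (\<lambda>i. texp (\<psi> (trop_unit i)) i') (snd s' (Inr i'))"
        by (rule coherent[OF T])
    qed
  qed
  then show ?thesis
    using that[of \<psi>] \<psi>(1,2) by blast
qed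

section \<open>Universality and bases\<close>

lemma coherent_combination_diff:
  assumes "coherent_combination Bt S c v" "coherent_combination Bt S c' v"
  shows "coherent_combination Bt S (\<lambda>i. c i - c' i) (\<lambda>_. 0)"
  using assms by (simp add: coherent_combination_def left_diff_distrib sum_subtractf mutated_row_zero)

text \<open>
  Two specializations express each target row as a coherent combination; the difference
  is a coherent relation among the source rows, so independence makes the two matrices equal.
\<close>

lemma coeff_specialization_unique:
  fixes s :: "('n::{finite,linorder}, 'i) seed" and s' :: "('n, 'j) seed"
  assumes R: "underlying_field R" and s: "is_seed R I s" and s': "is_seed R I' s'"
    and indep: "rows_independent R I (snd s)"
    and \<phi>: "coeff_specialization R I s I' s' \<phi>" "coeff_specialization R I s I' s' \<phi>'"
    and ext: "\<phi> \<in> extensional (cluster_algebra R I s)" "\<phi>' \<in> extensional (cluster_algebra R I s)"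
  shows "\<phi> = \<phi>'"
proof (rule coeff_specialization_eqI[OF R s s' \<phi> ext])
  fix a assume a: "a \<in> tropical R I"
  obtain \<psi> where \<psi>: "\<forall>a\<in>tropical R I. \<psi> a \<in> tropical R I' \<and> \<phi> (trop_elem a) = trop_elem (\<psi> a)"
    "\<forall>i'\<in>I'. coherent_coordinate R I (snd s) \<psi> i' (snd s' (Inr i'))"
    by (rule coeff_specialization_coherent[OF R s \<phi>(1)])
  obtain \<psi>' where \<psi>': "\<forall>a\<in>tropical R I. \<psi>' a \<in> tropical R I' \<and> \<phi>' (trop_elem a) = trop_elem (\<psi>' a)"
    "\<forall>i'\<in>I'. coherent_coordinate R I (snd s) \<psi>' i' (snd s' (Inr i'))"
    by (rule coeff_specialization_coherent[OF R s \<phi>(2)])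
  have "texp (\<psi> a) i' = texp (\<psi>' a) i'" for i'
  proof (cases "i' \<in> I'")
    case True
    let ?c = "\<lambda>i. texp (\<psi> (trop_unit i)) i'" and ?c' = "\<lambda>i. texp (\<psi>' (trop_unit i)) i'"
    have mem: "\<forall>i\<in>I. ?c i \<in> R" "\<forall>i\<in>I. ?c' i \<in> R"
      using bspec[OF \<psi>(2) True] bspec[OF \<psi>'(2) True] by (simp_all add: coherent_coordinate_def)
    obtain S where S: "finite S" "S \<subseteq> I" "\<forall>T. finite T \<longrightarrow> S \<subseteq> T \<longrightarrow> T \<subseteq> I \<longrightarrow>
        (\<forall>a\<in>tropical R I. texp (\<psi> a) i' = (\<Sum>i\<in>T. ?c i * texp a i)) \<and>
        coherent_combination (snd s) T ?c (snd s' (Inr i'))"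
      using bspec[OF \<psi>(2) True] unfolding coherent_coordinate_def by (elim conjE exE)
    obtain S' where S': "finite S'" "S' \<subseteq> I" "\<forall>T. finite T \<longrightarrow> S' \<subseteq> T \<longrightarrow> T \<subseteq> I \<longrightarrow>
        (\<forall>a\<in>tropical R I. texp (\<psi>' a) i' = (\<Sum>i\<in>T. ?c' i * texp a i)) \<and>
        coherent_combination (snd s) T ?c' (snd s' (Inr i'))"
      using bspec[OF \<psi>'(2) True] unfolding coherent_coordinate_def by (elim conjE exE)
    let ?T = "S \<union> S'"
    have T: "finite ?T" "?T \<subseteq> I"
      using S(1,2) S'(1,2) by auto
    note at_T = S(3)[THEN spec, of ?T, THEN mp, OF T(1), THEN mp, OF Un_upper1, THEN mp, OF T(2)]
      S'(3)[THEN spec, of ?T, THEN mp, OF T(1), THEN mp, OF Un_upper2, THEN mp, OF T(2)]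
    have "coherent_combination (snd s) ?T (\<lambda>i. ?c i - ?c' i) (\<lambda>_. 0)"
      by (rule coherent_combination_diff[OF at_T(1)[THEN conjunct2] at_T(2)[THEN conjunct2]])
    then have "\<forall>i\<in>?T. ?c i - ?c' i = 0"
      by (rule rows_independentD[OF indep _ T])
        (use T(2) mem in \<open>auto simp: subset_iff intro!: underlying_fieldD(8)[OF R]\<close>)
    then have "(\<Sum>i\<in>?T. ?c i * texp a i) = (\<Sum>i\<in>?T. ?c' i * texp a i)"
      by (intro sum.cong) auto
    then show ?thesis
      by (simp only: bspec[OF at_T(1)[THEN conjunct1] a] bspec[OF at_T(2)[THEN conjunct1] a])
  next
    case False
    then show ?thesis
      using \<psi>(1) \<psi>'(1) a by (simp add: tropical_def)
  qed
  then have "\<psi> a = \<psi>' a"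
    by (simp add: trop_eq_iff)
  then show "\<phi> (trop_elem a) = \<phi>' (trop_elem a)"
    using \<psi>(1) \<psi>'(1) a by simp
qed

lemma universal_wrt_if_basis:
  assumes R: "underlying_field R" and Bt: "ext_exchange_matrix R I Bt"
    and span: "rows_span R I Bt" and indep: "rows_independent R I Bt"
  shows "universal_wrt TYPE('j) R I (Bt :: ('n::{finite,linorder}, 'i) ext_matrix)"
  unfolding universal_wrt_def
proof (intro conjI Bt allI impI, elim conjE)
  fix I' :: "'j set" and Bt' :: "('n, 'j) ext_matrix" and x x'
  assume Bt': "ext_exchange_matrix R I' Bt'" and B: "\<forall>i j. Bt' (Inl i) j = Bt (Inl i) j"
    and s: "is_seed R I (x, Bt)" and s': "is_seed R I' (x', Bt')"
  have "\<exists>S c. finite S \<and> S \<subseteq> I \<and> (\<forall>i\<in>S. c i \<in> R) \<and> coherent_combination Bt S c (Bt' (Inr i'))"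
    if "i' \<in> I'" for i'
    using span ext_exchange_matrix_mem(2)[OF R Bt' that] unfolding rows_span_def by blast
  then obtain S p where p: "\<And>i'. i' \<in> I' \<Longrightarrow> finite (S i')" "\<And>i'. i' \<in> I' \<Longrightarrow> S i' \<subseteq> I"
    "\<And>i' i. i' \<in> I' \<Longrightarrow> i \<in> S i' \<Longrightarrow> p i' i \<in> R"
    "\<And>i'. i' \<in> I' \<Longrightarrow> coherent_combination Bt (S i') (p i') (Bt' (Inr i'))"
    by metis
  obtain \<phi> where "\<phi> \<in> extensional (cluster_algebra R I (x, Bt))"
    "coeff_specialization R I (x, Bt) I' (x', Bt') \<phi>"
    by (rule coeff_specialization_exists[OF R s s', of S p]) (use B p in auto)
  then show "\<exists>!\<phi>. \<phi> \<in> extensional (cluster_algebra R I (x, Bt)) \<and>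
      coeff_specialization R I (x, Bt) I' (x', Bt') \<phi>"
    using coeff_specialization_unique[OF R s s'] indep by auto
qed

text \<open>
  To extract information from universality it suffices to use targets with a single coefficient
  row, over the initial cluster of indeterminates.
\<close>

lemma universal_wrt_specialization_to_row:
  fixes Bt :: "('n::{finite,linorder}, 'i) ext_matrix" and v :: "'n \<Rightarrow> real" and i' :: 'j
  assumes R: "underlying_field R" and univ: "universal_wrt TYPE('j) R I Bt" and v: "\<forall>j. v j \<in> R"
  defines "Bt' \<equiv> case_sum (\<lambda>k. Bt (Inl k)) (\<lambda>_. v)"
  shows "is_seed R {i'} (indet, Bt')"
    "\<exists>!\<phi>. \<phi> \<in> extensional (cluster_algebra R I (indet, Bt)) \<and>
      coeff_specialization R I (indet, Bt) {i'} (indet, Bt') \<phi>"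
proof -
  have Bt: "ext_exchange_matrix R I Bt"
    using univ by (simp add: universal_wrt_def)
  then have Bt': "ext_exchange_matrix R {i'} Bt'"
    using v by (simp add: ext_exchange_matrix_def extends_matrix_def Bt'_def)
  have s: "is_seed R I (indet, Bt)"
    by (rule is_seed_indet[OF R Bt])
  show s': "is_seed R {i'} (indet, Bt')"
    by (rule is_seed_indet[OF R Bt'])
  show "\<exists>!\<phi>. \<phi> \<in> extensional (cluster_algebra R I (indet, Bt)) \<and>
      coeff_specialization R I (indet, Bt) {i'} (indet, Bt') \<phi>"
    using univ s s' Bt' unfolding universal_wrt_def by (simp add: Bt'_def)
qed

text \<open>
  The specialization to the matrix with the single coefficient row \<open>v\<close> expresses \<open>v\<close>.
\<close>

lemma rows_span_if_universal_wrt: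
  fixes Bt :: "('n::{finite,linorder}, 'i) ext_matrix"
  assumes R: "underlying_field R" and univ: "universal_wrt TYPE('j) R I Bt"
  shows "rows_span R I Bt"
  unfolding rows_span_def
proof (intro allI impI)
  fix v :: "'n \<Rightarrow> real" assume v: "\<forall>j. v j \<in> R"
  define i' :: 'j where "i' = undefined"
  let ?Bt' = "case_sum (\<lambda>k. Bt (Inl k)) (\<lambda>_. v)"
  have s: "is_seed R I (indet, Bt)"
    using univ by (intro is_seed_indet R) (simp add: universal_wrt_def)
  note row = universal_wrt_specialization_to_row[OF R univ v, of i']
  obtain \<phi> where \<phi>: "coeff_specialization R I (indet, Bt) {i'} (indet, ?Bt') \<phi>"
    using ex1_implies_ex[OF row(2)] by (elim exE conjE)
  obtain \<psi> where coord: "coherent_coordinate R I Bt \<psi> i' v"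
    by (rule coeff_specialization_coherent[OF R s \<phi>]) simp
  let ?c = "\<lambda>i. texp (\<psi> (trop_unit i)) i'"
  obtain S where S: "finite S" "S \<subseteq> I"
    "\<forall>T. finite T \<longrightarrow> S \<subseteq> T \<longrightarrow> T \<subseteq> I \<longrightarrow>
      (\<forall>a\<in>tropical R I. texp (\<psi> a) i' = (\<Sum>i\<in>T. ?c i * texp a i)) \<and> coherent_combination Bt T ?c v"
    using coord unfolding coherent_coordinate_def by (elim conjE exE)
  then have "coherent_combination Bt S ?c v"
    by simp
  moreover have "\<forall>i\<in>S. ?c i \<in> R"
    using coord S(2) by (auto simp: coherent_coordinate_def)
  ultimately show "\<exists>S c. finite S \<and> S \<subseteq> I \<and> (\<forall>i\<in>S. c i \<in> R) \<and> coherent_combination Bt S c v"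
    using S(1,2) by (intro exI[of _ S] exI[of _ ?c] conjI)
qed

text \<open>
  A coherent relation \<open>c\<close> and the zero relation both define specializations to the matrix with a
  single zero row. These coincide by universality, and comparing them on the generator \<open>u\<^sub>k\<close>
  gives \<open>c k = 0\<close>.
\<close>

lemma rows_independent_if_universal_wrt:
  fixes Bt :: "('n::{finite,linorder}, 'i) ext_matrix"
  assumes R: "underlying_field R" and univ: "universal_wrt TYPE('j) R I Bt"
  shows "rows_independent R I Bt"
  unfolding rows_independent_def
proof (intro allI impI ballI, elim conjE)
  fix S c k
  assume S: "finite S" "S \<subseteq> I" and c: "\<forall>i\<in>S. c i \<in> R" and rel: "coherent_combination Bt S c (\<lambda>_. 0)"
    and k: "k \<in> S"
  define i' :: 'j where "i' = undefined"
  let ?s = "(indet, Bt)" and ?s' = "(indet, case_sum (\<lambda>k. Bt (Inl k)) (\<lambda>_ _. 0))"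
  let ?A = "cluster_algebra R I ?s" and ?e = "trop_elem (trop_unit k) :: ('n, 'i) ratfun"
  have s: "is_seed R I (indet, Bt)"
    using univ by (intro is_seed_indet R) (simp add: universal_wrt_def)
  note row = universal_wrt_specialization_to_row[OF R univ, of "\<lambda>_. 0" i',
      OF allI[OF underlying_fieldD(1)[OF R]]]
  have unit: "trop_unit k \<in> tropical R I"
    using S k by (intro trop_unit_tropical R) auto
  have zero: "coherent_combination Bt {} (\<lambda>_. 0) (\<lambda>_. 0)"
    by (simp add: coherent_combination_def mutated_row_zero)
  obtain \<phi> where \<phi>: "\<phi> \<in> extensional ?A" "coeff_specialization R I ?s {i'} ?s' \<phi>"
    "\<phi> ?e = trop_elem (trop_matrix_map {i'} (\<lambda>_. S) (\<lambda>_. c) (trop_unit k))"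
    by (rule coeff_specialization_exists[OF R s row(1), of "\<lambda>_. S" "\<lambda>_. c"])
      (use S c rel unit in auto)
  obtain \<phi>' where \<phi>': "\<phi>' \<in> extensional ?A" "coeff_specialization R I ?s {i'} ?s' \<phi>'"
    "\<phi>' ?e = trop_elem (trop_matrix_map {i'} (\<lambda>_. {}) (\<lambda>_ _. 0) (trop_unit k))"
    by (rule coeff_specialization_exists[OF R s row(1), of "\<lambda>_. {}" "\<lambda>_ _. 0"])
      (use zero unit in auto)
  have "\<phi> = \<phi>'"
    using row(2) \<phi>(1,2) \<phi>'(1,2) by blast
  then have "trop_matrix_map {i'} (\<lambda>_. S) (\<lambda>_. c) (trop_unit k) =
      trop_matrix_map {i'} (\<lambda>_. {}) (\<lambda>_ _. 0) (trop_unit k)"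
    using \<phi>(3) \<phi>'(3) by (simp add: trop_elem_inj)
  from arg_cong[OF this, of "\<lambda>a. texp a i'"]
  have "(\<Sum>i\<in>S. if i = k then c i else 0) = 0"
    by (simp add: texp_trop_matrix_map trop_unit_def if_distrib cong: if_cong)
  then show "c k = 0"
    using S(1) k by simp
qed

text \<open>
  The basis conditions speak about \<open>Bt\<close> alone, so universality passes from one type of target
  indices to every other.
\<close>

theorem universal_wrt_iff_basis:
  assumes "underlying_field R"
  shows "universal_wrt TYPE('j) R I (Bt :: ('n::{finite,linorder}, 'i) ext_matrix) \<longleftrightarrow>
    ext_exchange_matrix R I Bt \<and> rows_span R I Bt \<and> rows_independent R I Bt"
  (is "?univ \<longleftrightarrow> ?basis")
proof
  assume ?univ
  then show ?basis
    using rows_span_if_universal_wrt[OF assms] rows_independent_if_universal_wrt[OF assms]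
    by (auto simp: universal_wrt_def)
next
  assume ?basis
  then show ?univ
    by (intro universal_wrt_if_basis[OF assms]) auto
qed

section \<open>Existence of a basis\<close>

text \<open>
  Rows are indexed by themselves, so that a set of rows is its own index set. Relations are
  finite, whence unions of chains of independent sets are independent. If \<open>v\<close> is outside a maximal
  independent set, a relation involving \<open>v\<close> has an invertible coefficient at \<open>v\<close>, and dividing by
  it expresses \<open>v\<close>. The division preserves coherence because each of the equations is linear in the
  coefficients.
\<close>

lemma exists_basis:
  fixes M :: "'n::finite \<Rightarrow> 'n \<Rightarrow> real"
  assumes R: "underlying_field R"
  defines "Bt \<equiv> case_sum M (\<lambda>v. v)"
  obtains I where "\<And>v j. v \<in> I \<Longrightarrow> v j \<in> R" "rows_span R I Bt" "rows_independent R I Bt"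
proof -
  define Z where "Z = {I. (\<forall>v\<in>I. \<forall>j. v j \<in> R) \<and> rows_independent R I Bt}"
  have "{} \<in> Z"
    by (auto simp: Z_def rows_independent_def)
  moreover have "\<Union>C \<in> Z" if C: "C \<noteq> {}" "subset.chain Z C" for C
  proof -
    have "rows_independent R (\<Union>C) Bt"
      unfolding rows_independent_def
    proof (intro allI impI, elim conjE)
      fix S c
      assume S: "finite S" "S \<subseteq> \<Union>C" "\<forall>i\<in>S. c i \<in> R" "coherent_combination Bt S c (\<lambda>_. 0)"
      obtain I where "I \<in> C" "S \<subseteq> I"
        using finite_subset_Union_chain[OF S(1,2) C] by blast
      moreover have "rows_independent R I Bt"
        using C(2) \<open>I \<in> C\<close> by (auto simp: Z_def subset.chain_def)
      ultimately show "\<forall>i\<in>S. c i = 0"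
        using S(3) by (intro rows_independentD[OF _ S(4,1)]) auto
    qed
    then show ?thesis
      using C(2) by (auto simp: Z_def subset.chain_def)
  qed
  ultimately obtain I where I: "I \<in> Z" "\<And>J. J \<in> Z \<Longrightarrow> I \<subseteq> J \<Longrightarrow> J = I"
    using subset_Zorn_nonempty[of Z] by blast
  have row: "fold mutate_matrix t Bt (Inr v) j = mutated_row (\<lambda>k. Bt (Inl k)) t v j" for t v j
    by (simp add: fold_mutate_matrix_Inr) (simp add: Bt_def)
  have "rows_span R I Bt"
    unfolding rows_span_def
  proof (intro allI impI)
    fix v :: "'n \<Rightarrow> real" assume v: "\<forall>j. v j \<in> R"
    show "\<exists>S c. finite S \<and> S \<subseteq> I \<and> (\<forall>i\<in>S. c i \<in> R) \<and> coherent_combination Bt S c v"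
    proof (cases "v \<in> I")
      case True
      have "coherent_combination Bt {v} (\<lambda>_. 1) v"
        by (simp add: coherent_combination_def row)
      then show ?thesis
        using True underlying_fieldD(2)[OF R] by (intro exI[of _ "{v}"] exI[of _ "\<lambda>_. 1"]) auto
    next
      case False
      then have "insert v I \<notin> Z"
        using I(2)[of "insert v I"] by blast
      then have "\<not> rows_independent R (insert v I) Bt"
        using I(1) v by (auto simp: Z_def)
      then obtain S c where S: "finite S" "S \<subseteq> insert v I" "\<forall>i\<in>S. c i \<in> R"
        "coherent_combination Bt S c (\<lambda>_. 0)" "\<not> (\<forall>i\<in>S. c i = 0)"
        unfolding rows_independent_def by blast
      have indep: "rows_independent R I Bt"
        using I(1) by (simp add: Z_def)
      have vS: "v \<in> S"
        using rows_independentD[OF indep S(4,1)] S(2,3,5) by blast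
      have rel: "c v * mutated_row (\<lambda>k. Bt (Inl k)) t v j +
            (\<Sum>i\<in>S - {v}. c i * fold mutate_matrix t Bt (Inr i) j) = 0"
          "c v * min (mutated_row (\<lambda>k. Bt (Inl k)) t v j) 0 +
            (\<Sum>i\<in>S - {v}. c i * min (fold mutate_matrix t Bt (Inr i) j) 0) = 0"
        if "t \<in> tree_vertices" for t j
        using S(4) that sum.remove[OF S(1) vS, of "\<lambda>i. c i * fold mutate_matrix t Bt (Inr i) j"]
          sum.remove[OF S(1) vS, of "\<lambda>i. c i * min (fold mutate_matrix t Bt (Inr i) j) 0"]
        by (simp_all add: coherent_combination_def mutated_row_zero row)
      have "c v \<noteq> 0"
      proof
        assume cv: "c v = 0"
        have "coherent_combination Bt (S - {v}) c (\<lambda>_. 0)"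
          using rel by (simp add: coherent_combination_def mutated_row_zero cv)
        moreover have "S - {v} \<subseteq> I"
          using S(2) by auto
        ultimately have "\<forall>i\<in>S - {v}. c i = 0"
          using S(1,3) by (intro rows_independentD[OF indep]) auto
        with cv S(5) show False by auto
      qed
      have solve: "(\<Sum>i\<in>S - {v}. - inverse (c v) * c i * f i) = a"
        if "c v * a + (\<Sum>i\<in>S - {v}. c i * f i) = 0" for f a
      proof -
        have "(\<Sum>i\<in>S - {v}. - inverse (c v) * c i * f i) = - inverse (c v) * (\<Sum>i\<in>S - {v}. c i * f i)"
          by (simp add: sum_distrib_left mult.assoc)
        also have "(\<Sum>i\<in>S - {v}. c i * f i) = - (c v * a)"
          using that by linarith
        finally show ?thesis
          using \<open>c v \<noteq> 0\<close> by simp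
      qed
      have "coherent_combination Bt (S - {v}) (\<lambda>i. - inverse (c v) * c i) v"
        unfolding coherent_combination_def by (intro ballI allI conjI solve rel)
      moreover have "- inverse (c v) * c i \<in> R" if "i \<in> S" for i
        using S(3) that vS by (intro underlying_fieldD(5,6,7)[OF R]) auto
      ultimately show ?thesis
        using S(1,2) by (intro exI[of _ "S - {v}"] exI[of _ "\<lambda>i. - inverse (c v) * c i"]) auto
    qed
  qed
  then show ?thesis
    using that[of I] I(1) by (auto simp: Z_def)
qed

(* The matrix whose existence is claimed must not depend on the index set of the coefficient rows
   of the target, which is a subset of an arbitrary type 'j, and HOL has no quantifier over types
   below an existential quantifier. The first conjunct therefore asserts the existence of a matrix
   that is universal for targets with index sets in the fixed type 'n \<Rightarrow> real; the second one asserts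
   that each such matrix is universal for targets with index sets in every type. *)
theorem corollary4p7:
  fixes B :: "int ^ 'n::{finite,linorder} ^ 'n::{finite,linorder}" and R :: "real set"
  assumes "underlying_field R" and "exchange_matrix B"
  shows "(\<exists>(I :: ('n \<Rightarrow> real) set) Bt. extends_matrix Bt B \<and> universal_wrt TYPE('n \<Rightarrow> real) R I Bt) \<and>
    (\<forall>(I :: ('n \<Rightarrow> real) set) Bt. extends_matrix Bt B \<and> universal_wrt TYPE('n \<Rightarrow> real) R I Bt \<longrightarrow>
       universal_wrt TYPE('j) R I Bt)"
proof
  let ?Bt = "case_sum (\<lambda>i j. of_int (B $ i $ j)) (\<lambda>v. v) :: ('n, 'n \<Rightarrow> real) ext_matrix"
  obtain I where I: "\<And>v j. v \<in> I \<Longrightarrow> v j \<in> R" "rows_span R I ?Bt" "rows_independent R I ?Bt"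
    using exists_basis[OF assms(1)] by blast
  have ext: "extends_matrix ?Bt B"
    by (simp add: extends_matrix_def)
  moreover have "ext_exchange_matrix R I ?Bt"
    using ext I(1) assms(2) by (auto simp: ext_exchange_matrix_def)
  ultimately show "\<exists>(I :: ('n \<Rightarrow> real) set) Bt. extends_matrix Bt B \<and>
      universal_wrt TYPE('n \<Rightarrow> real) R I Bt"
    using I(2,3) by (auto simp: universal_wrt_iff_basis[OF assms(1)])
  show "\<forall>(I :: ('n \<Rightarrow> real) set) Bt. extends_matrix Bt B \<and>
      universal_wrt TYPE('n \<Rightarrow> real) R I Bt \<longrightarrow> universal_wrt TYPE('j) R I Bt"
    by (simp add: universal_wrt_iff_basis[OF assms(1)])
qed

end
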